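(* For every $\tau\in\mathbb H$, with $q=e^{2\pi i\tau}$, the vector $$H(\tau)=\begin{pmatrix}q^{-1/6}P_0(q)\\ q^{-1/6}P_1(q)\end{pmatrix}$$ satisfies $$H\left(-\frac1{13\tau}\right)=S_{13}H(\tau),\qquad S_{13}=\frac1{\sqrt{13}}\begin{pmatrix}\gamma&\beta\\ \alpha&-\gamma\end{pmatrix}.$$ Moreover $S_{13}^2=I$ and $H(\tau+1)=e^{-\pi i/3}H(\tau)$.
   Context: $\mathbb H$ is the upper half-plane. For $\tau\in\mathbb H$ put $q=e^{2\pi i\tau}$; fractional powers always mean $q^r=e^{2\pi i r\tau}$ (so when the argument of $H$ is $-1/(13\tau)$, both $q$ and $q^{-1/6}$ are computed from that argument). Notation: $(a_1,\dots,a_k;q)_\infty=\prod_{i=1}^k\prod_{n\ge0}(1-a_iq^n)$. Define $$P_0(q)=(q,q^5,q^8,q^{12};q^{13})_\infty^{-1},\qquad P_1(q)=(q^2,q^3,q^{10},q^{11};q^{13})_\infty^{-1}.$$ Let $C_0=\{\pm1,\pm5\}$, $C_1=\{\pm2,\pm3\}$, $C_2=\{\pm4,\pm6\}$ (residue classes modulo 13; the cubic residues modulo 13 and their two cosets), $\zeta=e^{2\pi i/13}$, and $$\eta_j=\sum_{a\in C_j}\zeta^a\ (j=0,1,2),\qquad \alpha=\eta_1-\eta_2,\quad \beta=\eta_0-\eta_2,\quad \gamma=\eta_1-\eta_0.$$ $I$ is the $2\times2$ identity matrix and $\sqrt{13}>0$. *)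

theory Defs
  imports "HOL-Analysis.Analysis"
begin

definition qpoch_inf :: "complex \<Rightarrow> complex \<Rightarrow> complex" where
  "qpoch_inf a q = (\<Prod>n. 1 - a * q ^ n)"

definition qpochs_inf :: "complex list \<Rightarrow> complex \<Rightarrow> complex" where
  "qpochs_inf as q = (\<Prod>a\<leftarrow>as. qpoch_inf a q)"

definition P0 :: "complex \<Rightarrow> complex" where
  "P0 q = inverse (qpochs_inf [q, q ^ 5, q ^ 8, q ^ 12] (q ^ 13))"

definition P1 :: "complex \<Rightarrow> complex" where
  "P1 q = inverse (qpochs_inf [q ^ 2, q ^ 3, q ^ 10, q ^ 11] (q ^ 13))"

text \<open>
  Fractional powers of the nome are taken as functions of \<open>\<tau>\<close>, not of \<open>q\<close>:
  \<open>nome_powr \<tau> r\<close> is \<open>q^r = exp (2 \<pi> i r \<tau>)\<close>, so no branch of the logarithm is involved.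
\<close>
definition nome_powr :: "complex \<Rightarrow> real \<Rightarrow> complex" where
  "nome_powr \<tau> r = exp (2 * of_real pi * \<i> * of_real r * \<tau>)"

definition nome :: "complex \<Rightarrow> complex" where
  "nome \<tau> = exp (2 * of_real pi * \<i> * \<tau>)"

definition H :: "complex \<Rightarrow> complex ^ 2" where
  "H \<tau> = vector [nome_powr \<tau> (-1/6) * P0 (nome \<tau>), nome_powr \<tau> (-1/6) * P1 (nome \<tau>)]"

text \<open>
  Integer representatives of the cubic residues modulo 13 and of their two cosets.
\<close>
definition C0 :: "int set" where "C0 = {1, -1, 5, -5}"
definition C1 :: "int set" where "C1 = {2, -2, 3, -3}"
definition C2 :: "int set" where "C2 = {4, -4, 6, -6}"

definition zeta13 :: complex where
  "zeta13 = exp (2 * of_real pi * \<i> / 13)"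

definition cubic_period :: "int set \<Rightarrow> complex" where
  "cubic_period C = (\<Sum>a\<in>C. zeta13 powi a)"

definition alpha13 :: complex where
  "alpha13 = cubic_period C1 - cubic_period C2"

definition beta13 :: complex where
  "beta13 = cubic_period C0 - cubic_period C2"

definition gamma13 :: complex where
  "gamma13 = cubic_period C1 - cubic_period C0"

definition S13 :: "complex ^ 2 ^ 2" where
  "S13 = (\<chi> i j. 1 / of_real (sqrt 13) *
     (vector [vector [gamma13, beta13], vector [alpha13, - gamma13]] :: complex ^ 2 ^ 2) $ i $ j)"

end

theory Submission
  imports Defs "HOL-Complex_Analysis.Complex_Analysis"
begin

text \<open>
  Let \<open>theta z \<tau>\<close> be the odd Jacobi theta function and
  \<open>phi k \<tau> = q^(k\<^sup>2/26) theta (k\<tau>) (13\<tau>)\<close>.  The product expansion of theta identifies the two entries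
  of \<open>H\<close> as \<open>eta(13\<tau>)\<^sup>2 / p0\<close> and \<open>eta(13\<tau>)\<^sup>2 / p1\<close>, where \<open>p0 = phi 1 phi 5\<close>,
  \<open>p1 = phi 2 phi 3\<close>; put also \<open>p2 = phi 4 phi 6\<close>.  The theorem is true because of three facts
  about these products.  Two of them use the series for theta, which the triple product provides.

  The inversion \<open>\<tau> \<mapsto> - 1/\<tau>\<close> turns \<open>phi k\<close>, evaluated at \<open>- 1/(13\<tau>)\<close>, into a multiple of the
  torsion value \<open>theta (k/13) \<tau>\<close>, by a factor that does not depend on \<open>k\<close>
  (\<open>theta_inversion\<close>, \<open>phi_inversion\<close>).

  The product \<open>theta (a/13) \<tau> * theta (5a/13) \<tau>\<close> is a sum over a translate of the Gaussian
  integers, twisted by a character that is trivial on the ideal \<open>(3 + 2i)\<close> of norm 13.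
  On each coset of this ideal the character is constant, and multiplication by \<open>3 + 2i\<close>, followed
  by a shift, parametrizes the coset by the full lattice, with \<open>q\<close> replaced by \<open>q^13\<close>.
  So the product is a linear combination \<open>L\<close> of \<open>p0\<close>, \<open>p1\<close>, \<open>p2\<close> whose coefficients are signed
  sums of 13th roots of unity (\<open>theta_product_13\<close>, \<open>theta_product_phi\<close>).

  Weierstrass' three-term relation gives \<open>1/p0 = 1/p1 + 1/p2\<close> (\<open>phi_relation\<close>).  Hence \<open>p2\<close> can be
  eliminated, and \<open>(p1 - p0) L\<close> becomes a binary quadratic form in \<open>p0\<close>, \<open>p1\<close>.  The cubic
  periods make it split: the three linear forms with coefficients \<open>\<alpha>\<close>, \<open>\<beta>\<close>, \<open>\<gamma>\<close> multiply to a
  cubic, and each of the three forms \<open>(p1 - p0) L\<close> is, up to a common factor, the product of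
  two of them (\<open>fricke_algebra\<close>).  So \<open>1/L\<close> is the remaining linear form times something
  independent of the choice of \<open>L\<close>, which is the matrix identity up to a scalar \<open>K(\<tau>)\<close>.

  It remains to see that \<open>K(\<tau>) = 1/\<surd>13\<close>.  The products of all six \<open>phi k\<close> and of all six
  \<open>theta (k/13)\<close> are eta products, and a comparison of \<open>eta (- 1/\<tau>)\<close> with \<open>eta \<tau>\<close> through the three
  2-torsion values of theta shows that \<open>K^6\<close> is constant (\<open>fricke_up_to_scalar\<close>).  As \<open>K\<close> is
  continuous on a connected set, \<open>K\<close> itself is constant, and its value can be read off
  at the fixed point \<open>i/\<surd>13\<close> of \<open>\<tau> \<mapsto> - 1/(13\<tau>)\<close>, where both entries of \<open>H\<close> are positive
  (\<open>fricke_H\<close>).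
\<close>

section \<open>Infinite products\<close>

lemma qpoch_inf_has_prod:
  assumes "norm q < 1"
  shows "(\<lambda>n. 1 - a * q ^ n) has_prod qpoch_inf a q"
proof -
  have "summable (\<lambda>n. norm (- a * q ^ n))"
    using assms by (simp add: norm_mult norm_power summable_mult summable_geometric)
  hence "abs_convergent_prod (\<lambda>n. 1 + (- a * q ^ n))"
    by (intro summable_imp_abs_convergent_prod) simp
  hence "convergent_prod (\<lambda>n. 1 - a * q ^ n)"
    by (intro abs_convergent_prod_imp_convergent_prod) simp
  thus ?thesis
    unfolding qpoch_inf_def by (rule convergent_prod_has_prod)
qed

lemma qpoch_inf_LIMSEQ:
  assumes "norm q < 1"
  shows "(\<lambda>N. \<Prod>n<N. 1 - a * q ^ n) \<longlonglongrightarrow> qpoch_inf a q"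
  using has_prod_imp_tendsto'[OF qpoch_inf_has_prod[OF assms]] .

lemma qpoch_inf_eq_0_iff:
  assumes "norm q < 1"
  shows "qpoch_inf a q = 0 \<longleftrightarrow> (\<exists>n. a * q ^ n = 1)"
  using has_prod_eq_0_iff[OF qpoch_inf_has_prod[OF assms, of a]]
  unfolding image_iff by (metis (no_types, lifting) UNIV_I eq_iff_diff_eq_0)

lemma qpoch_inf_self_nonzero:
  assumes "norm q < 1"
  shows "qpoch_inf q q \<noteq> 0"
proof -
  have "norm (q * q ^ n) < 1" for n
    using assms power_less_one_iff[of "norm q" "Suc n"] by (simp add: norm_mult norm_power)
  hence "q * q ^ n \<noteq> 1" for n
    by (metis norm_one order_less_irrefl)
  thus ?thesis
    by (simp add: qpoch_inf_eq_0_iff[OF assms])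
qed

lemma qpoch_inf_rec:
  assumes "norm q < 1"
  shows "qpoch_inf a q = (1 - a) * qpoch_inf (a * q) q"
proof -
  have "(\<lambda>N. (1 - a) * (\<Prod>n<N. 1 - a * q * q ^ n)) \<longlonglongrightarrow> (1 - a) * qpoch_inf (a * q) q"
    by (intro tendsto_intros qpoch_inf_LIMSEQ assms)
  also have "(\<lambda>N. (1 - a) * (\<Prod>n<N. 1 - a * q * q ^ n)) = (\<lambda>N. \<Prod>n<Suc N. 1 - a * q ^ n)"
    by (simp add: prod.lessThan_Suc_shift mult_ac del: prod.lessThan_Suc)
  finally show ?thesis
    using qpoch_inf_LIMSEQ[OF assms, of a] LIMSEQ_Suc LIMSEQ_unique by blast
qed

text \<open>
  Sorting the exponents by their residue modulo \<open>m\<close>.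
\<close>
lemma qpoch_inf_prod_powers:
  assumes "norm q < 1" "m > 0"
  shows "(\<Prod>r<m. qpoch_inf (a * q ^ r) (q ^ m)) = qpoch_inf a q"
proof -
  have q: "norm (q ^ m) < 1"
    using assms by (simp add: norm_power power_less_one_iff)
  have "(\<lambda>N. \<Prod>r<m. \<Prod>n<N. 1 - a * q ^ r * (q ^ m) ^ n) \<longlonglongrightarrow>
          (\<Prod>r<m. qpoch_inf (a * q ^ r) (q ^ m))"
    by (intro tendsto_intros qpoch_inf_LIMSEQ q)
  also have "(\<lambda>N. \<Prod>r<m. \<Prod>n<N. 1 - a * q ^ r * (q ^ m) ^ n) = (\<lambda>N. \<Prod>n<N * m. 1 - a * q ^ n)"
  proof
    fix N
    have "a * q ^ r * (q ^ m) ^ n = a * q ^ (r + m * n)" for r n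
      by (simp add: power_add power_mult)
    hence "(\<Prod>r<m. \<Prod>n<N. 1 - a * q ^ r * (q ^ m) ^ n) =
            (\<Prod>n<N. \<Prod>r<m. 1 - a * q ^ (r + m * n))"
      by (subst prod.swap) (simp only:)
    also have "\<dots> = (\<Prod>n<N. prod (\<lambda>i. 1 - a * q ^ i) {n * m..<n * m + m})"
    proof (rule prod.cong[OF refl])
      fix n
      show "(\<Prod>r<m. 1 - a * q ^ (r + m * n)) = prod (\<lambda>i. 1 - a * q ^ i) {n * m..<n * m + m}"
        by (rule prod.reindex_bij_witness[of _ "\<lambda>i. i - n * m" "\<lambda>r. r + n * m"])
           (auto simp: mult_ac)
    qed
    also have "\<dots> = (\<Prod>n<N * m. 1 - a * q ^ n)"
      by (rule prod.nat_group)
    finally show "(\<Prod>r<m. \<Prod>n<N. 1 - a * q ^ r * (q ^ m) ^ n) = (\<Prod>n<N * m. 1 - a * q ^ n)" .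
  qed
  finally have "(\<lambda>N. \<Prod>n<N * m. 1 - a * q ^ n) \<longlonglongrightarrow> (\<Prod>r<m. qpoch_inf (a * q ^ r) (q ^ m))" .
  moreover have "filterlim (\<lambda>N. N * m) sequentially sequentially"
    using mult_nat_left_at_top[OF assms(2)] by (simp add: mult.commute[of m])
  hence "(\<lambda>N. \<Prod>n<N * m. 1 - a * q ^ n) \<longlonglongrightarrow> qpoch_inf a q"
    by (rule filterlim_compose[OF qpoch_inf_LIMSEQ[OF assms(1)]])
  ultimately show ?thesis
    by (rule LIMSEQ_unique)
qed

text \<open>
  The hypothesis says that the \<open>c r\<close> are the \<open>m\<close>-th roots of unity; it is used below for \<open>m = 2\<close>
  (squaring \<open>q\<close>) and for \<open>m = 13\<close>.
\<close>
lemma qpoch_inf_prod_eq: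
  assumes "norm q < 1" "m > 0" "finite R" "\<And>y. (\<Prod>r\<in>R. 1 - c r * y) = 1 - y ^ m"
  shows "(\<Prod>r\<in>R. qpoch_inf (c r * a) q) = qpoch_inf (a ^ m) (q ^ m)"
proof -
  have q: "norm (q ^ m) < 1"
    using assms by (simp add: norm_power power_less_one_iff)
  have "(\<lambda>N. \<Prod>r\<in>R. \<Prod>n<N. 1 - c r * a * q ^ n) \<longlonglongrightarrow> (\<Prod>r\<in>R. qpoch_inf (c r * a) q)"
    by (intro tendsto_intros qpoch_inf_LIMSEQ assms)
  also have "(\<lambda>N. \<Prod>r\<in>R. \<Prod>n<N. 1 - c r * a * q ^ n) = (\<lambda>N. \<Prod>n<N. 1 - a ^ m * (q ^ m) ^ n)"
  proof
    fix N
    have "(\<Prod>r\<in>R. \<Prod>n<N. 1 - c r * a * q ^ n) = (\<Prod>n<N. \<Prod>r\<in>R. 1 - c r * (a * q ^ n))"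
      by (subst prod.swap) (simp add: mult_ac)
    also have "\<dots> = (\<Prod>n<N. 1 - a ^ m * (q ^ m) ^ n)"
      by (simp add: assms(4) power_mult_distrib flip: power_mult) (simp add: mult.commute)
    finally show "(\<Prod>r\<in>R. \<Prod>n<N. 1 - c r * a * q ^ n) = (\<Prod>n<N. 1 - a ^ m * (q ^ m) ^ n)" .
  qed
  finally show ?thesis
    using qpoch_inf_LIMSEQ[OF q] LIMSEQ_unique by blast
qed

lemma qpoch_inf_holomorphic:
  assumes "open A" "f holomorphic_on A" "g holomorphic_on A" "\<And>x. x \<in> A \<Longrightarrow> norm (g x) < 1"
  shows "(\<lambda>x. qpoch_inf (f x) (g x)) holomorphic_on A"
proof (rule holomorphic_uniform_sequence[OF assms(1)])
  show "(\<lambda>x. \<Prod>n<N. 1 - f x * g x ^ n) holomorphic_on A" for N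
    by (intro holomorphic_intros assms)
next
  fix x assume "x \<in> A"
  then obtain d where d: "d > 0" "cball x d \<subseteq> A"
    using assms(1) open_contains_cball by blast
  have contf: "continuous_on (cball x d) f" and contg: "continuous_on (cball x d) g"
    using d assms holomorphic_on_imp_continuous_on continuous_on_subset by blast+
  have "bounded (f ` cball x d)"
    by (intro compact_imp_bounded compact_continuous_image contf compact_cball)
  then obtain B where B: "\<And>y. y \<in> cball x d \<Longrightarrow> norm (f y) \<le> B"
    unfolding bounded_iff by blast
  have "\<exists>y\<in>cball x d. \<forall>z\<in>cball x d. norm (g z) \<le> norm (g y)"
    using d by (intro continuous_attains_sup continuous_intros contg) auto
  then obtain y where y: "y \<in> cball x d" "\<And>z. z \<in> cball x d \<Longrightarrow> norm (g z) \<le> norm (g y)"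
    by blast
  have r: "norm (g y) < 1"
    using y d assms(4) by blast
  have "B \<ge> 0"
    using order.trans[OF norm_ge_zero B[of x]] d by simp
  have "uniformly_convergent_on (cball x d) (\<lambda>N x. \<Prod>n<N. 1 - f x * g x ^ n)"
  proof (rule uniformly_convergent_on_prod')
    show "uniformly_convergent_on (cball x d) (\<lambda>N x. \<Sum>n<N. norm (1 - f x * g x ^ n - 1))"
    proof (rule Weierstrass_m_test'_ev)
      show "\<forall>\<^sub>F n in sequentially. \<forall>z\<in>cball x d.
              norm (norm (1 - f z * g z ^ n - 1)) \<le> B * norm (g y) ^ n"
        using B y(2) \<open>B \<ge> 0\<close>
        by (intro always_eventually allI ballI)
           (auto simp: norm_mult norm_power intro!: mult_mono power_mono)
      show "summable (\<lambda>n. B * norm (g y) ^ n)"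
        using r by (intro summable_mult summable_geometric) auto
    qed
  qed (auto intro!: continuous_intros contf contg)
  then obtain l where l: "uniform_limit (cball x d) (\<lambda>N x. \<Prod>n<N. 1 - f x * g x ^ n) l sequentially"
    unfolding uniformly_convergent_on_def by blast
  have "l z = qpoch_inf (f z) (g z)" if "z \<in> cball x d" for z
    using tendsto_uniform_limitI[OF l that] qpoch_inf_LIMSEQ[of "g z" "f z"] assms(4)[of z] that d(2)
    by (blast intro: LIMSEQ_unique)
  hence "uniform_limit (cball x d) (\<lambda>N x. \<Prod>n<N. 1 - f x * g x ^ n)
           (\<lambda>x. qpoch_inf (f x) (g x)) sequentially"
    using l by (metis (no_types, lifting) uniform_limit_cong')
  thus "\<exists>d>0. cball x d \<subseteq> A \<and> uniform_limit (cball x d) (\<lambda>N x. \<Prod>n<N. 1 - f x * g x ^ n)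
           (\<lambda>x. qpoch_inf (f x) (g x)) sequentially"
    using d by blast
qed

section \<open>The Jacobi triple product\<close>

text \<open>
  The Gaussian binomial coefficient, defined by one of its two Pascal recursions.  This one avoids
  subtraction in the exponent; it comes from splitting off the factor \<open>1 - y\<close>, not the
  last one, in the product of the \<open>q\<close>-binomial theorem.
\<close>
fun qbinomial :: "complex \<Rightarrow> nat \<Rightarrow> nat \<Rightarrow> complex" where
  "qbinomial q n 0 = 1"
| "qbinomial q 0 (Suc k) = 0"
| "qbinomial q (Suc n) (Suc k) = q ^ Suc k * qbinomial q n (Suc k) + qbinomial q n k"

lemma qbinomial_eq_0: "k > n \<Longrightarrow> qbinomial q n k = 0"
  by (induction q n k rule: qbinomial.induct) auto

lemma triangular_Suc: "Suc k * (Suc k - 1) div 2 = k * (k - 1) div 2 + k"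
  by (cases k) (auto simp: algebra_simps)

lemma qbinomial_theorem:
  "(\<Prod>k<n. 1 - y * q ^ k) = (\<Sum>i\<le>n. (-1) ^ i * q ^ (i * (i - 1) div 2) * y ^ i * qbinomial q n i)"
proof (induction n arbitrary: y)
  case (Suc n)
  define t where "t = (\<lambda>i::nat. q ^ (i * (i - 1) div 2))"
  have t: "t (Suc i) = t i * q ^ i" for i
    unfolding t_def triangular_Suc by (simp add: power_add)
  define U where "U = (\<lambda>z. \<Sum>i\<le>n. (-1) ^ i * t i * z ^ i * qbinomial q n i)"
  have "U (y * q) = (\<Sum>i\<le>Suc n. (-1) ^ i * t i * (y * q) ^ i * qbinomial q n i)"
    by (simp add: qbinomial_eq_0 U_def)
  also have "\<dots> = 1 + (\<Sum>i\<le>n. (-1) ^ Suc i * t (Suc i) * (y * q) ^ Suc i * qbinomial q n (Suc i))"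
    by (subst sum.atMost_Suc_shift) (simp add: t_def)
  finally have 1: "U (y * q) = \<dots>" .
  have 2: "y * U (y * q) = (\<Sum>i\<le>n. - ((-1) ^ Suc i * t (Suc i) * y ^ Suc i * qbinomial q n i))"
    unfolding U_def sum_distrib_left
    by (intro sum.cong refl) (simp add: t power_mult_distrib mult_ac)
  have "(\<Prod>k<Suc n. 1 - y * q ^ k) = (1 - y) * (\<Prod>k<n. 1 - (y * q) * q ^ k)"
    by (simp add: prod.lessThan_Suc_shift mult_ac del: prod.lessThan_Suc)
  also have "\<dots> = U (y * q) - y * U (y * q)"
    unfolding Suc.IH by (simp add: algebra_simps U_def t_def)
  also have "\<dots> = 1 + (\<Sum>i\<le>n. (-1) ^ Suc i * t (Suc i) * y ^ Suc i * qbinomial q (Suc n) (Suc i))"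
    unfolding 2 unfolding 1 sum_negf diff_minus_eq_add add.assoc sum.distrib[symmetric]
    by (intro arg_cong2[where f = "(+)"] refl sum.cong) (simp add: algebra_simps power_mult_distrib)
  also have "\<dots> = (\<Sum>i\<le>Suc n. (-1) ^ i * t i * y ^ i * qbinomial q (Suc n) i)"
    by (subst sum.atMost_Suc_shift) (simp add: t_def)
  finally show ?case
    unfolding t_def .
qed auto

lemma qbinomial_closed_form:
  "qbinomial q (i + j) i * (\<Prod>k<i. 1 - q * q ^ k) * (\<Prod>k<j. 1 - q * q ^ k) = (\<Prod>k<i+j. 1 - q * q ^ k)"
proof (induction "i + j" arbitrary: i j)
  case (Suc n)
  let ?Q = "\<lambda>n. \<Prod>k<n. 1 - q * q ^ k"
  consider "i = 0" | "j = 0" "i > 0" | i' j' where "i = Suc i'" "j = Suc j'"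
    by (metis not0_implies_Suc neq0_conv)
  thus ?case
  proof cases
    case 1
    show ?thesis unfolding 1 by simp
  next
    case 2
    have "qbinomial q n n = 1" for n
      by (induction n) (auto simp: qbinomial_eq_0)
    thus ?thesis unfolding 2 by simp
  next
    case (3 i' j')
    have 1: "qbinomial q n i' * ?Q i' * ?Q (Suc j') = ?Q n"
      using Suc.hyps(1)[of i' "Suc j'"] Suc.hyps(2) 3 by simp
    have 2: "qbinomial q n (Suc i') * ?Q (Suc i') * ?Q j' = ?Q n"
      using Suc.hyps(1)[of "Suc i'" "j'"] Suc.hyps(2) 3 by simp
    have ij: "i + j = Suc n" using Suc.hyps(2) by simp
    have n: "n = Suc (i' + j')" using 3 ij by simp
    have "qbinomial q (i + j) i * ?Q i * ?Q j =
       q ^ Suc i' * (1 - q * q ^ j') * (qbinomial q n (Suc i') * ?Q (Suc i') * ?Q j') +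
       (1 - q * q ^ i') * (qbinomial q n i' * ?Q i' * ?Q (Suc j'))"
      unfolding ij unfolding 3 by (simp add: algebra_simps)
    also have "\<dots> = (q ^ Suc i' * (1 - q * q ^ j') + (1 - q * q ^ i')) * ?Q n"
      unfolding 1 2 by (simp add: algebra_simps)
    also have "q ^ Suc i' * (1 - q * q ^ j') + (1 - q * q ^ i') = 1 - q * q ^ n"
      by (simp add: algebra_simps power_add n)
    finally show ?thesis
      unfolding ij by (simp add: mult.commute)
  qed
qed simp

text \<open>
  The exponent \<open>j (j - 1) div 2\<close> is an exact division, so the terms are single-valued in \<open>q\<close>.
  No half-integral powers occur.
\<close>
definition jacobi_term :: "complex \<Rightarrow> complex \<Rightarrow> int \<Rightarrow> complex" where
  "jacobi_term x q j = (-1) powi j * q powi (j * (j - 1) div 2) * x powi j"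

definition jacobi_prod :: "complex \<Rightarrow> complex \<Rightarrow> complex" where
  "jacobi_prod x q = qpoch_inf q q * qpoch_inf x q * qpoch_inf (q / x) q"

text \<open>
  Completing the square: the terms of the \<open>q\<close>-binomial theorem for \<open>y = x / q^n\<close> are, up to a common
  factor, the terms of the triple product shifted by \<open>n\<close>.
\<close>
lemma jacobi_term_shift:
  assumes "x \<noteq> 0" "q \<noteq> 0"
  shows "jacobi_term x q (int i - int n) =
    (-1) ^ n * q ^ (Suc n * n div 2) / x ^ n *
      ((-1) ^ i * q ^ (i * (i - 1) div 2) * (x / q ^ n) ^ i)"
proof -
  define a where "a = int i * (int i - 1) div 2"
  define b where "b = (int n + 1) * int n div 2"
  have a: "2 * a = int i * (int i - 1)" unfolding a_def by simp
  have b: "2 * b = (int n + 1) * int n" unfolding b_def by simp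
  have "2 * ((int i - int n) * (int i - int n - 1) div 2) = (int i - int n) * (int i - int n - 1)"
    by (intro dvd_mult_div_cancel) auto
  hence exp: "(int i - int n) * (int i - int n - 1) div 2 = b + a - int n * int i"
    using a b by (simp add: algebra_simps)
  have "int (i * (i - 1) div 2) = a"
    unfolding a_def by (cases i) (auto simp: zdiv_int algebra_simps)
  hence 1: "q ^ (i * (i - 1) div 2) = q powi a"
    by (metis power_int_of_nat)
  have "int (Suc n * n div 2) = b"
    unfolding b_def by (simp add: zdiv_int algebra_simps)
  hence 2: "q ^ (Suc n * n div 2) = q powi b"
    by (metis power_int_of_nat)
  have 3: "(-1 :: complex) powi (int i - int n) = (-1) ^ n * (-1) ^ i"
    by (simp add: power_int_diff field_simps)
  have 4: "q powi (int i * int n) = (q ^ n) ^ i"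
    by (metis mult.commute of_nat_mult power_int_of_nat power_mult)
  show ?thesis
    using assms unfolding jacobi_term_def exp 1 2 3
    by (simp add: power_int_diff power_int_add 4 field_simps)
qed

text \<open>
  The \<open>q\<close>-binomial theorem with \<open>2 n\<close> factors, centred at its middle: the factors with negative
  exponent are turned around by \<open>1 - x / q^k = (- x / q^k) (1 - q^k / x)\<close>.
\<close>
lemma finite_jacobi_triple_product:
  assumes "x \<noteq> 0" "q \<noteq> 0"
  shows "(\<Prod>k<n. 1 - x * q ^ k) * (\<Prod>k<n. 1 - q / x * q ^ k) =
           (\<Sum>i\<le>2*n. qbinomial q (2 * n) i * jacobi_term x q (int i - int n))"
proof -
  define c where "c = (-1) ^ n * q ^ (Suc n * n div 2) / x ^ n"
  have "(\<Prod>k<n. 1 - x / q ^ n * q ^ k) = (\<Prod>k<n. 1 - x / q ^ n * q ^ (n - Suc k))"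
    by (subst prod.nat_diff_reindex) auto
  also have "\<dots> = (\<Prod>k<n. (- x / q ^ Suc k) * (1 - q / x * q ^ k))"
  proof (intro prod.cong refl)
    fix k assume "k \<in> {..<n}"
    hence "q ^ n = q ^ (n - Suc k) * q ^ Suc k"
      by (metis Suc_leI le_add_diff_inverse2 lessThan_iff power_add)
    thus "1 - x / q ^ n * q ^ (n - Suc k) = (- x / q ^ Suc k) * (1 - q / x * q ^ k)"
      using assms by (simp add: field_simps)
  qed
  also have "\<dots> = (\<Prod>k<n. - x / q ^ Suc k) * (\<Prod>k<n. 1 - q / x * q ^ k)"
    by (rule prod.distrib)
  finally have 1: "(\<Prod>k<n. 1 - x / q ^ n * q ^ k) = \<dots>" .
  have 2: "c * (\<Prod>k<n. - x / q ^ Suc k) = 1"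
  proof -
    have "(\<Prod>k<m. - x / q ^ Suc k) = (-1) ^ m * x ^ m / q ^ (Suc m * m div 2)" for m
    proof (induction m)
      case (Suc m)
      have "Suc (Suc m) * Suc m div 2 = Suc m * m div 2 + Suc m"
        by (simp add: algebra_simps)
      thus ?case
        unfolding prod.lessThan_Suc Suc.IH by (simp add: power_add field_simps)
    qed auto
    thus ?thesis
      using assms unfolding c_def by (simp flip: power_mult_distrib)
  qed
  have "(\<Prod>k<n + m. 1 - x / q ^ n * q ^ k) = (\<Prod>k<n. 1 - x / q ^ n * q ^ k) * (\<Prod>k<m. 1 - x * q ^ k)" for m
    using assms by (induction m) (auto simp: power_add)
  from this[of n] have 3: "(\<Prod>k<2 * n. 1 - x / q ^ n * q ^ k) =
      (\<Prod>k<n. 1 - x / q ^ n * q ^ k) * (\<Prod>k<n. 1 - x * q ^ k)"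
    by (simp add: mult_2)
  have "(\<Prod>k<n. 1 - x * q ^ k) * (\<Prod>k<n. 1 - q / x * q ^ k) =
        c * (\<Prod>k<2 * n. 1 - x / q ^ n * q ^ k)"
    using 2 unfolding 3 unfolding 1 by (simp add: mult_ac)
  also have "\<dots> = (\<Sum>i\<le>2*n. qbinomial q (2 * n) i * jacobi_term x q (int i - int n))"
    unfolding qbinomial_theorem sum_distrib_left jacobi_term_shift[OF assms] c_def
    by (simp add: mult_ac)
  finally show ?thesis .
qed

text \<open>
  The symmetry \<open>x \<mapsto> q / x\<close> reduces summability over the integers to summability over the
  naturals.
\<close>
lemma jacobi_term_neg:
  assumes "x \<noteq> 0" "q \<noteq> 0"
  shows "jacobi_term x q (- j) = jacobi_term (q / x) q j"
proof -
  have "2 * (- j * (- j - 1) div 2) = 2 * (j * (j - 1) div 2 + j)"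
    by (simp add: algebra_simps)
  hence "- j * (- j - 1) div 2 = j * (j - 1) div 2 + j" by simp
  thus ?thesis
    using assms unfolding jacobi_term_def
    by (simp add: power_int_add power_int_divide_distrib power_int_minus field_simps)
qed

lemma summable_jacobi_term_nat:
  assumes "norm q < 1" "x \<noteq> 0" "q \<noteq> 0"
  shows "summable (\<lambda>n. norm (jacobi_term x q (int n)))"
proof -
  have "jacobi_term x q (int (Suc n)) = - (q ^ n * x) * jacobi_term x q (int n)" for n
  proof -
    have "2 * (int (Suc n) * (int (Suc n) - 1) div 2) = 2 * (int n * (int n - 1) div 2 + int n)"
      by (simp add: algebra_simps)
    hence "int (Suc n) * (int (Suc n) - 1) div 2 = int n * (int n - 1) div 2 + int n"
      by simp
    thus ?thesis
      using assms unfolding jacobi_term_def by (simp add: power_int_add field_simps)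
  qed
  hence rec: "norm (jacobi_term x q (int (Suc n))) = norm q ^ n * norm x * norm (jacobi_term x q (int n))" for n
    by (simp add: norm_mult norm_power)
  have "(\<lambda>n. norm q ^ n * norm x) \<longlonglongrightarrow> 0 * norm x"
    using assms by (intro tendsto_intros LIMSEQ_power_zero) auto
  hence "eventually (\<lambda>n. norm q ^ n * norm x < 1 / 2) sequentially"
    by (rule order_tendstoD) simp
  then obtain N where N: "\<And>n. n \<ge> N \<Longrightarrow> norm q ^ n * norm x < 1 / 2"
    unfolding eventually_sequentially by blast
  show ?thesis
  proof (rule summable_ratio_test)
    fix n assume "n \<ge> N"
    from mult_right_mono[OF less_imp_le[OF N[OF this]] norm_ge_zero]
    show "norm (norm (jacobi_term x q (int (Suc n)))) \<le> 1 / 2 * norm (norm (jacobi_term x q (int n)))"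
      unfolding rec by (simp add: abs_mult)
  qed simp
qed

lemma abs_summable_jacobi_term:
  assumes "norm q < 1" "x \<noteq> 0" "q \<noteq> 0"
  shows "(\<lambda>j. norm (jacobi_term x q j)) summable_on UNIV"
proof -
  have nat: "(\<lambda>j. norm (jacobi_term y q j)) summable_on range int" if "y \<noteq> 0" for y
    using summable_jacobi_term_nat[OF assms(1) that assms(3)]
    by (subst summable_on_reindex) (auto simp: o_def summable_on_UNIV_nonneg_real_iff)
  have "(\<lambda>j. norm (jacobi_term x q j)) summable_on uminus ` range int"
    using nat[of "q / x"] assms
    by (subst summable_on_reindex) (auto simp: o_def jacobi_term_neg)
  hence "(\<lambda>j. norm (jacobi_term x q j)) summable_on (range int \<union> uminus ` range int)"
    using nat[OF assms(2)] by (intro summable_on_union)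
  also have "range int \<union> uminus ` range int = UNIV"
    by (auto simp: image_iff) (metis int_cases2)
  finally show ?thesis .
qed

text \<open>
  Let \<open>n\<close> tend to infinity in the finite version.  The quotients of \<open>q\<close>-factorials that occur as
  coefficients are bounded and converge to \<open>1 / (q; q)\<^sub>\<infinity>\<close>, so Tannery's theorem applies.
\<close>
theorem jacobi_triple_product:
  assumes "norm q < 1" "x \<noteq> 0" "q \<noteq> 0"
  shows "(jacobi_term x q has_sum jacobi_prod x q) UNIV"
proof -
  let ?Q = "\<lambda>n. \<Prod>k<n. 1 - q * q ^ k"
  \<comment> \<open>Tannery's theorem is about sums over the naturals, so the integers are enumerated.\<close>
  define J where "J = (\<lambda>k. jacobi_term x q (int_decode k))"
  have Q: "?Q \<longlonglongrightarrow> qpoch_inf q q"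
    by (rule qpoch_inf_LIMSEQ[OF assms(1)])
  have q_nz: "1 - q * q ^ k \<noteq> 0" for k
    using assms(1) power_less_one_iff[of "norm q" "Suc k"] by (auto simp flip: norm_power power_Suc)
  have Q0: "?Q n \<noteq> 0" for n
    using q_nz by simp
  have Qinf: "qpoch_inf q q \<noteq> 0"
    by (rule qpoch_inf_self_nonzero[OF assms(1)])
  have Qi: "(\<lambda>n. inverse (?Q n)) \<longlonglongrightarrow> inverse (qpoch_inf q q)"
    by (intro tendsto_inverse Q Qinf)
  obtain B where B: "B > 0" "\<And>n. norm (?Q n) \<le> B"
    using convergent_imp_Bseq[OF convergentI[OF Q]] unfolding Bseq_def by blast
  obtain B' where B': "B' > 0" "\<And>n. norm (inverse (?Q n)) \<le> B'"
    using convergent_imp_Bseq[OF convergentI[OF Qi]] unfolding Bseq_def by blast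
  have qb: "qbinomial q (i + j) i = ?Q (i + j) * inverse (?Q i) * inverse (?Q j)" for i j
    using qbinomial_closed_form[of q i j] Q0[of i] Q0[of j]
    by (simp add: field_simps del: prod_zero_iff)
  define a where "a = (\<lambda>k n. qbinomial q (2 * n) (nat (int n + int_decode k)) *
                       (if int_decode k \<ge> - int n then J k else 0))"
  have a_eq: "a k n = ?Q (2 * n) * inverse (?Q (nat (int n + int_decode k))) *
                        inverse (?Q (nat (int n - int_decode k))) * J k"
    if "\<bar>int_decode k\<bar> \<le> int n" for k n
  proof -
    have "2 * n = nat (int n + int_decode k) + nat (int n - int_decode k)"
      using that by linarith
    thus ?thesis
      using qb[of "nat (int n + int_decode k)" "nat (int n - int_decode k)"] that
      by (simp add: a_def)
  qed
  have a_0: "a k n = 0" if "\<bar>int_decode k\<bar> > int n" for k n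
    using that by (auto simp: a_def intro!: qbinomial_eq_0)
  have "summable (\<lambda>k. norm (J k))"
    using abs_summable_jacobi_term[OF assms]
    unfolding summable_on_reindex_bij_betw[OF bij_int_decode, of "\<lambda>j. norm (jacobi_term x q j)", symmetric]
    by (simp add: J_def summable_on_UNIV_nonneg_real_iff)
  hence summ: "summable (\<lambda>k. B * B' * B' * norm (J k))"
    by (rule summable_mult)
  have "(\<lambda>n. \<Sum>k. a k n) \<longlonglongrightarrow> (\<Sum>k. inverse (qpoch_inf q q) * J k)"
  proof (rule conjunct2[OF conjunct2[OF tannerys_theorem[OF _ _ summ]]])
    fix k
    let ?j = "int_decode k"
    have "(\<lambda>n. ?Q (2 * n) * inverse (?Q (nat (int n + ?j))) *
                        inverse (?Q (nat (int n - ?j))) * J k) \<longlonglongrightarrow>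
          qpoch_inf q q * inverse (qpoch_inf q q) * inverse (qpoch_inf q q) * J k"
    proof (intro tendsto_intros Qinf filterlim_compose[OF Q] filterlim_compose[OF Qi])
      show "filterlim (\<lambda>n. 2 * n) sequentially sequentially"
        by (rule mult_nat_left_at_top) simp
      show "filterlim (\<lambda>n. nat (int n + ?j)) sequentially sequentially"
           "filterlim (\<lambda>n. nat (int n - ?j)) sequentially sequentially"
        unfolding filterlim_at_top
      proof safe
        fix M
        show "eventually (\<lambda>n. nat (int n + ?j) \<ge> M) sequentially"
             "eventually (\<lambda>n. nat (int n - ?j) \<ge> M) sequentially"
          using eventually_ge_at_top[of "M + nat \<bar>?j\<bar>"] by (eventually_elim, linarith)+
      qed
    qed
    hence "(\<lambda>n. ?Q (2 * n) * inverse (?Q (nat (int n + ?j))) *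
                        inverse (?Q (nat (int n - ?j))) * J k) \<longlonglongrightarrow> inverse (qpoch_inf q q) * J k"
      using Qinf by simp
    moreover have "eventually (\<lambda>n. ?Q (2 * n) * inverse (?Q (nat (int n + ?j))) *
                        inverse (?Q (nat (int n - ?j))) * J k = a k n) sequentially"
      using eventually_ge_at_top[of "nat \<bar>?j\<bar>"] by eventually_elim (subst a_eq, auto)
    ultimately show "(\<lambda>n. a k n) \<longlonglongrightarrow> inverse (qpoch_inf q q) * J k"
      by (rule Lim_transform_eventually)
  next
    have "norm (a k n) \<le> B * B' * B' * norm (J k)" for k n
    proof (cases "\<bar>int_decode k\<bar> \<le> int n")
      case True
      show ?thesis
        unfolding a_eq[OF True] norm_mult
        by (intro mult_mono B B' mult_nonneg_nonneg norm_ge_zero order.refl less_imp_le[OF B(1)] less_imp_le[OF B'(1)])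
    qed (use B B' in \<open>auto simp: a_0\<close>)
    thus "\<forall>\<^sub>F (k, n) in at_top \<times>\<^sub>F sequentially. norm (a k n) \<le> B * B' * B' * norm (J k)"
      by (intro always_eventually) auto
  qed auto
  moreover have "(\<Sum>k. a k n) = (\<Prod>k<n. 1 - x * q ^ k) * (\<Prod>k<n. 1 - q / x * q ^ k)" for n
  proof -
    have fin: "finite {k. \<bar>int_decode k\<bar> \<le> int n}"
    proof -
      have "{k. \<bar>int_decode k\<bar> \<le> int n} \<subseteq> int_encode ` {- int n..int n}"
        by (auto simp: image_iff) (metis abs_le_iff atLeastAtMost_iff int_decode_inverse minus_le_iff)
      thus ?thesis by (rule finite_subset) auto
    qed
    have "(\<Sum>k. a k n) = (\<Sum>k\<in>{k. \<bar>int_decode k\<bar> \<le> int n}. a k n)"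
      by (rule suminf_finite[OF fin]) (auto simp: a_0)
    also have "\<dots> = (\<Sum>i\<le>2*n. qbinomial q (2 * n) i * jacobi_term x q (int i - int n))"
      by (rule sum.reindex_bij_witness[of _ "\<lambda>i. int_encode (int i - int n)" "\<lambda>k. nat (int n + int_decode k)"])
         (auto simp: a_def J_def)
    finally show ?thesis
      using finite_jacobi_triple_product[OF assms(2,3), of n] by simp
  qed
  ultimately have "(\<lambda>n. (\<Prod>k<n. 1 - x * q ^ k) * (\<Prod>k<n. 1 - q / x * q ^ k)) \<longlonglongrightarrow>
                     (\<Sum>k. inverse (qpoch_inf q q) * J k)"
    by simp
  moreover have "(\<lambda>n. (\<Prod>k<n. 1 - x * q ^ k) * (\<Prod>k<n. 1 - q / x * q ^ k)) \<longlonglongrightarrow>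
                   qpoch_inf x q * qpoch_inf (q / x) q"
    by (intro tendsto_intros qpoch_inf_LIMSEQ assms)
  ultimately have "(\<Sum>k. inverse (qpoch_inf q q) * J k) = qpoch_inf x q * qpoch_inf (q / x) q"
    by (rule LIMSEQ_unique)
  moreover have J: "summable J"
    using \<open>summable (\<lambda>k. norm (J k))\<close> by (rule summable_norm_cancel)
  ultimately have "inverse (qpoch_inf q q) * (\<Sum>k. J k) = qpoch_inf x q * qpoch_inf (q / x) q"
    by (simp only: suminf_mult)
  hence "(\<Sum>k. J k) = jacobi_prod x q"
    using Qinf by (simp add: jacobi_prod_def field_simps)
  hence "(J has_sum jacobi_prod x q) UNIV"
    using norm_summable_imp_has_sum[OF \<open>summable (\<lambda>k. norm (J k))\<close>] J by (simp add: sums_iff)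
  thus ?thesis
    unfolding J_def has_sum_reindex_bij_betw[OF bij_int_decode] .
qed

section \<open>The theta function\<close>

lemma nome_add: "nome (x + y) = nome x * nome y"
  and nome_diff: "nome (x - y) = nome x / nome y"
  and nome_minus: "nome (- x) = inverse (nome x)"
  and nome_0: "nome 0 = 1"
  and nome_nonzero: "nome x \<noteq> 0"
  by (simp_all add: nome_def algebra_simps exp_add exp_diff exp_minus)

lemma nome_of_int: "nome (of_int n) = 1"
  unfolding nome_def by (metis exp_2pi_1_int mult.assoc mult.commute mult.left_commute)

lemma nome_half: "nome (1 / 2) = - 1"
  by (simp add: nome_def)

lemma nome_power: "nome x ^ n = nome (of_nat n * x)"
  by (simp add: nome_def flip: exp_of_nat_mult) (simp add: mult_ac)

lemma nome_power_int: "nome x powi n = nome (of_int n * x)"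
  by (cases n rule: int_cases2) (simp_all add: power_int_minus nome_power nome_minus)

lemma norm_nome: "norm (nome x) = exp (- (2 * pi * Im x))"
  by (simp add: nome_def norm_exp_eq_Re)

lemma norm_nome_less_1: "Im x > 0 \<Longrightarrow> norm (nome x) < 1"
  by (simp add: norm_nome)

lemma nome_eq_1_iff: "nome x = 1 \<longleftrightarrow> x \<in> \<int>"
proof
  assume "nome x = 1"
  then obtain n :: int where n: "Re (2 * of_real pi * \<i> * x) = 0"
      "Im (2 * of_real pi * \<i> * x) = of_int (2 * n) * pi"
    unfolding nome_def exp_eq_1 by blast
  have "x = of_int n"
    using n by (intro complex_eqI) auto
  thus "x \<in> \<int>" by simp
qed (auto elim!: Ints_cases simp: nome_of_int)

lemma nome_holomorphic [holomorphic_intros]: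
  "f holomorphic_on A \<Longrightarrow> (\<lambda>x. nome (f x)) holomorphic_on A"
  unfolding nome_def by (intro holomorphic_intros)

text \<open>
  This is minus the classical \<open>\<Sum> (- 1)^n q^((n + 1/2)\<^sup>2 / 2) e((n + 1/2) z)\<close>; this sign
  gives the product no sign in front and matches the summation index \<open>n - 1/2\<close> in \<open>theta_term\<close>.  Defining it by
  the product makes zeros and quasi-periods immediate, while the series is what products of
  two theta functions need.
\<close>
definition theta :: "complex \<Rightarrow> complex \<Rightarrow> complex" where
  "theta z \<tau> = nome (\<tau> / 8 - z / 2) * jacobi_prod (nome z) (nome \<tau>)"

definition theta_term :: "complex \<Rightarrow> complex \<Rightarrow> int \<Rightarrow> complex" where
  "theta_term z \<tau> n = nome ((of_int n - 1/2)\<^sup>2 / 2 * \<tau> + (of_int n - 1/2) * z + of_int n / 2)"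

lemma theta_term_eq: "theta_term z \<tau> n = nome (\<tau> / 8 - z / 2) * jacobi_term (nome z) (nome \<tau>) n"
proof -
  have *: "of_int (n * (n - 1) div 2) = (of_int n * (of_int n - 1) / 2 :: complex)"
  proof -
    have "2 * (n * (n - 1) div 2) = n * (n - 1)" by simp
    hence "of_int (2 * (n * (n - 1) div 2)) = (of_int (n * (n - 1)) :: complex)" by (simp only:)
    hence "2 * of_int (n * (n - 1) div 2) = (of_int n * (of_int n - 1) :: complex)"
      unfolding of_int_mult of_int_diff of_int_1 of_int_numeral .
    thus ?thesis by (metis nonzero_mult_div_cancel_left zero_neq_numeral)
  qed
  have "(-1) powi n = nome (of_int n / 2)"
    using nome_power_int[of "1/2" n] by (simp add: nome_half)
  hence "nome (\<tau> / 8 - z / 2) * jacobi_term (nome z) (nome \<tau>) n =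
     nome (\<tau> / 8 - z / 2 + (of_int n / 2 + of_int n * (of_int n - 1) / 2 * \<tau> + of_int n * z))"
    by (simp add: jacobi_term_def nome_power_int nome_add * )
  also have "\<tau> / 8 - z / 2 + (of_int n / 2 + of_int n * (of_int n - 1) / 2 * \<tau> + of_int n * z) =
     (of_int n - 1/2)\<^sup>2 / 2 * \<tau> + (of_int n - 1/2) * z + of_int n / 2"
    by (simp add: field_simps power2_eq_square)
  finally show ?thesis
    by (simp add: theta_term_def)
qed

lemma theta_has_sum:
  assumes "Im \<tau> > 0"
  shows "(theta_term z \<tau> has_sum theta z \<tau>) UNIV"
  unfolding theta_term_eq theta_def
  by (intro has_sum_cmult_right jacobi_triple_product norm_nome_less_1 assms nome_nonzero)

lemma theta_term_abs_summable:
  assumes "Im \<tau> > 0"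
  shows "(\<lambda>n. norm (theta_term z \<tau> n)) summable_on UNIV"
  unfolding theta_term_eq norm_mult
  by (intro summable_on_cmult_right abs_summable_jacobi_term norm_nome_less_1 assms nome_nonzero)

lemma theta_uminus:
  assumes "Im \<tau> > 0"
  shows "theta (- z) \<tau> = - theta z \<tau>"
proof -
  let ?q = "nome \<tau>" and ?x = "nome z"
  have q: "norm ?q < 1" using assms by (rule norm_nome_less_1)
  have 1: "qpoch_inf ?x ?q = (1 - ?x) * qpoch_inf (?q * ?x) ?q"
    using qpoch_inf_rec[OF q, of ?x] by (simp add: mult.commute)
  have 2: "qpoch_inf (inverse ?x) ?q = (1 - inverse ?x) * qpoch_inf (?q / ?x) ?q"
    using qpoch_inf_rec[OF q, of "inverse ?x"] by (simp add: field_simps)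
  have 3: "nome (\<tau> / 8 + z / 2) = nome (\<tau> / 8 - z / 2) * ?x"
    unfolding nome_add[symmetric] by (rule arg_cong[of _ _ nome]) simp
  show ?thesis
    unfolding theta_def jacobi_prod_def nome_minus 2 unfolding 1
    using 3 by (simp add: field_simps nome_nonzero)
qed

lemma theta_plus_1: "theta (z + 1) \<tau> = - theta z \<tau>"
proof -
  have "nome (\<tau> / 8 - (z + 1) / 2) = nome (\<tau> / 8 - z / 2) / nome (1/2)"
    unfolding nome_diff[symmetric] by (rule arg_cong[of _ _ nome]) (simp add: field_simps)
  moreover have "nome (z + 1) = nome z"
    using nome_of_int[of 1] by (simp add: nome_add)
  ultimately show ?thesis by (simp add: theta_def nome_half)
qed

lemma theta_plus_tau:
  assumes "Im \<tau> > 0"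
  shows "theta (z + \<tau>) \<tau> = - nome (- z - \<tau> / 2) * theta z \<tau>"
proof -
  let ?q = "nome \<tau>" and ?x = "nome z"
  have q: "norm ?q < 1" using assms by (rule norm_nome_less_1)
  have 1: "qpoch_inf ?x ?q = (1 - ?x) * qpoch_inf (?x * ?q) ?q"
    using qpoch_inf_rec[OF q, of ?x] by simp
  have 2: "qpoch_inf (inverse ?x) ?q = (1 - inverse ?x) * qpoch_inf (?q / ?x) ?q"
    using qpoch_inf_rec[OF q, of "inverse ?x"] by (simp add: field_simps)
  have 3: "nome (\<tau> / 8 - (z + \<tau>) / 2) = nome (- z - \<tau> / 2) * nome (\<tau> / 8 - z / 2) * ?x"
    unfolding nome_add[symmetric] by (rule arg_cong[of _ _ nome]) (simp add: field_simps)
  have 4: "?q / (?x * ?q) = inverse ?x"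
    by (simp add: field_simps nome_nonzero)
  show ?thesis
    unfolding theta_def jacobi_prod_def nome_add[of z] 3 4 2 unfolding 1
    by (simp add: field_simps nome_nonzero)
qed

lemma theta_eq_0_iff:
  assumes "Im \<tau> > 0"
  shows "theta z \<tau> = 0 \<longleftrightarrow> (\<exists>m n :: int. z = of_int m + of_int n * \<tau>)"
proof -
  let ?q = "nome \<tau>" and ?x = "nome z"
  have q: "norm ?q < 1" using assms by (rule norm_nome_less_1)
  have int: "nome w = 1 \<longleftrightarrow> (\<exists>m. w = of_int m)" for w
    by (auto simp: nome_eq_1_iff Ints_def)
  have q0: "qpoch_inf ?q ?q \<noteq> 0"
    by (rule qpoch_inf_self_nonzero[OF q])
  have "theta z \<tau> = 0 \<longleftrightarrow> (\<exists>n. ?x * ?q ^ n = 1) \<or> (\<exists>n. ?q / ?x * ?q ^ n = 1)"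
    using q0 by (simp add: theta_def jacobi_prod_def nome_nonzero qpoch_inf_eq_0_iff[OF q])
  also have "(\<exists>n. ?x * ?q ^ n = 1) \<longleftrightarrow> (\<exists>(n::nat) (m::int). z = of_int m - of_nat n * \<tau>)"
    by (simp add: nome_power int algebra_simps flip: nome_add)
  also have "(\<exists>n. ?q / ?x * ?q ^ n = 1) \<longleftrightarrow> (\<exists>(n::nat) (m::int). z = of_nat (Suc n) * \<tau> - of_int m)"
    by (simp add: nome_power int algebra_simps flip: nome_add nome_diff) (metis add.commute add_diff_cancel)
  also have "(\<exists>(n::nat) (m::int). z = of_int m - of_nat n * \<tau>) \<or>
             (\<exists>(n::nat) (m::int). z = of_nat (Suc n) * \<tau> - of_int m) \<longleftrightarrow>
             (\<exists>m n :: int. z = of_int m + of_int n * \<tau>)" (is "?A \<or> ?B \<longleftrightarrow> ?C")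
  proof safe
    fix n :: nat and m :: int
    show "\<exists>m' n' :: int. of_int m - of_nat n * \<tau> = of_int m' + of_int n' * \<tau>"
      by (rule exI[of _ m], rule exI[of _ "- int n"]) simp
    show "\<exists>m' n' :: int. of_nat (Suc n) * \<tau> - of_int m = of_int m' + of_int n' * \<tau>"
      by (rule exI[of _ "- m"], rule exI[of _ "int (Suc n)"]) simp
  next
    fix m n :: int
    assume *: "\<nexists>(k::nat) (l::int). of_int m + of_int n * \<tau> = of_nat (Suc k) * \<tau> - of_int l"
    show "\<exists>(k::nat) (l::int). of_int m + of_int n * \<tau> = of_int l - of_nat k * \<tau>"
    proof (cases "n > 0")
      case True
      then obtain k where "n = int (Suc k)"
        by (metis gr0_implies_Suc zero_less_imp_eq_int)
      hence "of_int m + of_int n * \<tau> = of_nat (Suc k) * \<tau> - of_int (- m)"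
        by simp
      thus ?thesis using * by blast
    next
      case False
      then obtain k where "n = - int k"
        by (metis int_cases2 not_less of_nat_0_le_iff le_less neg_0_equal_iff_equal of_nat_0 zero_less_imp_eq_int)
      thus ?thesis
        by (intro exI[of _ k] exI[of _ m]) simp
    qed
  qed
  finally show ?thesis .
qed

lemma theta_0: "Im \<tau> > 0 \<Longrightarrow> theta 0 \<tau> = 0"
  by (simp add: theta_eq_0_iff) (metis add.right_neutral mult_zero_left of_int_0)

lemma theta_holomorphic:
  assumes "open A" "f holomorphic_on A" "g holomorphic_on A" "\<And>x. x \<in> A \<Longrightarrow> Im (g x) > 0"
  shows "(\<lambda>x. theta (f x) (g x)) holomorphic_on A"
  unfolding theta_def jacobi_prod_def
  using assms by (intro holomorphic_intros qpoch_inf_holomorphic norm_nome_less_1) (auto simp: nome_nonzero)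

section \<open>Uniqueness and inversion of theta\<close>

lemma periodic_int_multiple:
  fixes g :: "complex \<Rightarrow> 'a"
  assumes "\<And>z. g (z + w) = g z"
  shows "g (z + of_int n * w) = g z"
proof -
  have nat: "g (z + of_nat k * w) = g z" for k z
  proof (induction k)
    case (Suc k)
    thus ?case using assms[of "z + of_nat k * w"] by (simp add: algebra_simps)
  qed simp
  show ?thesis
  proof (cases n rule: int_cases2)
    case (nonneg k)
    thus ?thesis using nat[of z k] by simp
  next
    case (nonpos k)
    thus ?thesis using nat[of "z - of_nat k * w" k] by simp
  qed
qed

lemma theta_simple_zero:
  assumes "Im \<tau> > 0"
  obtains D where "D \<noteq> 0" "((\<lambda>z. theta z \<tau>) has_field_derivative D) (at 0)"
proof -
  let ?q = "nome \<tau>"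
  define u where "u = (\<lambda>z. nome (\<tau> / 8 - z / 2) * (qpoch_inf ?q ?q * qpoch_inf (nome z * ?q) ?q * qpoch_inf (?q / nome z) ?q))"
  have q: "norm ?q < 1" using assms by (rule norm_nome_less_1)
  have theta: "theta z \<tau> = (1 - nome z) * u z" for z
    unfolding theta_def jacobi_prod_def u_def
    by (subst (2) qpoch_inf_rec[OF q]) simp
  have hol: "u holomorphic_on UNIV"
    unfolding u_def using q
    by (intro holomorphic_intros qpoch_inf_holomorphic) (auto simp: nome_nonzero)
  have "u 0 \<noteq> 0"
    by (simp add: u_def nome_0 nome_nonzero qpoch_inf_self_nonzero[OF q])
  have "u field_differentiable at 0"
    using hol by (simp add: holomorphic_on_open field_differentiable_def)
  then obtain u' where u': "(u has_field_derivative u') (at 0)"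
    unfolding field_differentiable_def by blast
  have "((\<lambda>z. (1 - nome z) * u z) has_field_derivative - (2 * of_real pi * \<i>) * u 0) (at 0)"
    unfolding nome_def by (rule derivative_eq_intros u' refl | simp)+
  thus ?thesis
    using \<open>u 0 \<noteq> 0\<close> that[of "- (2 * of_real pi * \<i>) * u 0"] by (simp add: theta)
qed

text \<open>
  The quotient of \<open>f\<close> and theta is doubly periodic.  Theta has only simple zeros, at the lattice
  points, and \<open>f\<close> vanishes there too, so the quotient extends to a bounded entire function and is
  constant by Liouville's theorem.
\<close>
theorem theta_unique:
  assumes \<tau>: "Im \<tau> > 0" and hol: "f holomorphic_on UNIV"
    and f1: "\<And>z. f (z + 1) = - f z" and f\<tau>: "\<And>z. f (z + \<tau>) = - nome (- z - \<tau> / 2) * f z"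
    and f0: "f 0 = 0"
  obtains c where "\<And>z. f z = c * theta z \<tau>"
proof -
  define t where "t = (\<lambda>z. theta z \<tau>)"
  have t1: "t (z + 1) = - t z" and t\<tau>: "t (z + \<tau>) = - nome (- z - \<tau> / 2) * t z" for z
    unfolding t_def by (rule theta_plus_1 theta_plus_tau[OF \<tau>])+
  have holt: "t holomorphic_on UNIV"
    unfolding t_def using \<tau> by (intro theta_holomorphic holomorphic_intros) auto
  have t0: "t 0 = 0"
    unfolding t_def by (rule theta_0[OF \<tau>])
  obtain D where D: "D \<noteq> 0" "(t has_field_derivative D) (at 0)"
    unfolding t_def using theta_simple_zero[OF \<tau>] by blast
  obtain d where d: "(f has_field_derivative d) (at 0)"
    using hol by (auto simp: holomorphic_on_open)
  \<comment> \<open>By periodicity the value that fills the hole at 0 also fits at the other lattice points.\<close>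
  define g where "g = (\<lambda>z. if t z = 0 then d / D else f z / t z)"
  have g1: "g (z + 1) = g z" and g\<tau>: "g (z + \<tau>) = g z" for z
    unfolding g_def t1 t\<tau> f1 f\<tau> by (simp_all add: nome_nonzero)
  have g_period: "g (z + (of_int m + of_int n * \<tau>)) = g z" for z m n
    using periodic_int_multiple[of g 1 z m, OF g1] periodic_int_multiple[of g \<tau> "z + of_int m" n, OF g\<tau>]
    by (simp add: add.assoc)

  have lim_t: "((\<lambda>z. t z / z) \<longlongrightarrow> D) (at 0)" and lim_f: "((\<lambda>z. f z / z) \<longlongrightarrow> d) (at 0)"
    using D(2) d unfolding has_field_derivative_iff by (simp_all add: t0 f0)
  have ev: "eventually (\<lambda>z. t z \<noteq> 0) (at 0)"
    using tendsto_imp_eventually_ne[OF lim_t D(1)] by eventually_elim auto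
  have "((\<lambda>z. (f z / z) / (t z / z)) \<longlongrightarrow> d / D) (at 0)"
    by (intro tendsto_intros lim_t lim_f D)
  moreover have "eventually (\<lambda>z. (f z / z) / (t z / z) = g z) (at 0)"
    using ev eventually_neq_at_within[of 0 0 UNIV] by eventually_elim (simp add: g_def)
  ultimately have "(g \<longlongrightarrow> d / D) (at 0)"
    by (rule Lim_transform_eventually)
  hence lim_g: "(g \<longlongrightarrow> g 0) (at 0)"
    by (simp add: g_def t0)
  obtain r where r: "r > 0" "\<And>z. z \<noteq> 0 \<Longrightarrow> dist z 0 < r \<Longrightarrow> t z \<noteq> 0"
    using ev unfolding eventually_at by auto
  have quot: "g holomorphic_on A" if "\<And>z. z \<in> A \<Longrightarrow> t z \<noteq> 0" for A
  proof -
    have "(\<lambda>z. f z / t z) holomorphic_on A"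
      using that hol holt by (intro holomorphic_intros) (auto intro: holomorphic_on_subset)
    thus ?thesis
      by (rule holomorphic_transform) (use that in \<open>auto simp: g_def\<close>)
  qed
  have "g holomorphic_on ball 0 r"
  proof (rule no_isolated_singularity')
    show "(g \<longlongrightarrow> g z) (at z within ball 0 r)" if "z \<in> {0}" for z
      using lim_g that by (auto intro: tendsto_within_subset)
    show "g holomorphic_on ball 0 r - {0}"
      by (rule quot) (use r in auto)
  qed auto
  hence diff_0: "g field_differentiable at 0"
    using r(1) by (simp add: holomorphic_on_open field_differentiable_def)
  have "g field_differentiable at z" for z
  proof (cases "t z = 0")
    case True
    then obtain m n where z: "z = of_int m + of_int n * \<tau>"
      unfolding t_def theta_eq_0_iff[OF \<tau>] by blast
    have "g (w - z) = g w" for w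
      using g_period[of "w - z" m n] z by simp
    hence eq: "g = g \<circ> (\<lambda>w. w - z)" by auto
    have "(g \<circ> (\<lambda>w. w - z)) field_differentiable at z"
      by (rule field_differentiable_compose) (use diff_0 in \<open>auto intro!: derivative_intros\<close>)
    thus ?thesis using eq by simp
  next
    case False
    have "open (t -` (- {0}))"
      using holomorphic_on_imp_continuous_on[OF holt] by (intro open_vimage) auto
    hence "open {z. t z \<noteq> 0}"
      by (simp add: vimage_def)
    moreover have "g holomorphic_on {z. t z \<noteq> 0}"
      by (rule quot) auto
    ultimately show ?thesis
      using False by (simp add: holomorphic_on_open field_differentiable_def)
  qed
  hence holg: "g holomorphic_on UNIV"
    by (simp add: holomorphic_on_open field_differentiable_def)
  \<comment> \<open>All values are attained on the compact period parallelogram.\<close>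
  have "bounded (range g)"
  proof -
    define K where "K = (\<lambda>(s, t). complex_of_real s + of_real t * \<tau>) ` ({0..1} \<times> {0..1})"
    have "compact K"
      unfolding K_def case_prod_unfold
      by (intro compact_continuous_image compact_Times compact_Icc continuous_intros)
    hence "compact (g ` K)"
      using holg by (intro compact_continuous_image)
        (auto intro: holomorphic_on_imp_continuous_on holomorphic_on_subset)
    moreover have "range g \<subseteq> g ` K"
    proof safe
      fix z
      define y where "y = Im z / Im \<tau>"
      define x where "x = Re z - y * Re \<tau>"
      define w where "w = of_real (frac x) + of_real (frac y) * \<tau>"
      have z: "z = of_real x + of_real y * \<tau>"
        using \<tau> by (simp add: complex_eq_iff x_def y_def)
      have "z = w + (of_int \<lfloor>x\<rfloor> + of_int \<lfloor>y\<rfloor> * \<tau>)"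
        unfolding z w_def frac_def by (simp add: algebra_simps)
      hence "g z = g w"
        using g_period by simp
      moreover have "w \<in> K"
        unfolding K_def w_def
        by (rule image_eqI[of _ _ "(frac x, frac y)"]) (auto intro!: less_imp_le[OF frac_lt_1])
      ultimately show "g z \<in> g ` K" by simp
    qed
    ultimately show ?thesis
      using bounded_subset compact_imp_bounded by blast
  qed
  then obtain c where c: "\<And>z. g z = c"
    using Liouville_theorem[OF holg] unfolding constant_on_def by auto
  have "f z = c * t z" for z
  proof (cases "t z = 0")
    case True
    then obtain m n where z: "z = of_int m + of_int n * \<tau>"
      unfolding t_def theta_eq_0_iff[OF \<tau>] by blast
    have "(f (z + 1) = 0) = (f z = 0)" "(f (z + \<tau>) = 0) = (f z = 0)" for z
      by (simp_all add: f1 f\<tau> nome_nonzero)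
    hence "f z = 0"
      using periodic_int_multiple[of "\<lambda>z. f z = 0" 1 0 m]
        periodic_int_multiple[of "\<lambda>z. f z = 0" \<tau> "of_int m" n] f0 z
      by simp
    thus ?thesis using True by simp
  next
    case False
    thus ?thesis using c[of z] by (simp add: g_def field_simps)
  qed
  thus ?thesis using that unfolding t_def by blast
qed

lemma Im_neg_inverse_pos: "Im \<tau> > 0 \<Longrightarrow> Im (- 1 / \<tau>) > 0"
  by (simp add: Im_divide sum_power2_gt_zero_iff complex_eq_iff)

text \<open>
  As a function of \<open>z\<close>, \<open>theta (z/\<tau>) (- 1/\<tau>)\<close> times a Gaussian factor has the quasi-periods of
  \<open>theta z \<tau>\<close>: inversion exchanges the roles of the periods 1 and \<open>\<tau>\<close>.  The value of the constant
  is left open, since it only contributes to the scalar \<open>K\<close>.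
\<close>
lemma theta_inversion:
  assumes "Im \<tau> > 0"
  obtains C where "\<And>z. theta (z / \<tau>) (- 1 / \<tau>) = C * nome (z\<^sup>2 / (2 * \<tau>)) * theta z \<tau>"
proof -
  have nz: "\<tau> \<noteq> 0" using assms by auto
  have \<tau>': "Im (- 1 / \<tau>) > 0"
    by (rule Im_neg_inverse_pos[OF assms])
  define f where "f = (\<lambda>z. nome (- z\<^sup>2 / (2 * \<tau>)) * theta (z / \<tau>) (- 1 / \<tau>))"
  have "f holomorphic_on UNIV"
    unfolding f_def using nz \<tau>' by (intro holomorphic_intros theta_holomorphic) auto
  moreover have "f (z + \<tau>) = - nome (- z - \<tau> / 2) * f z" for z
  proof -
    have "nome (- (z + \<tau>)\<^sup>2 / (2 * \<tau>)) = nome (- z - \<tau> / 2) * nome (- z\<^sup>2 / (2 * \<tau>))"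
      unfolding nome_add[symmetric] using nz
      by (intro arg_cong[of _ _ nome]) (simp add: field_simps power2_eq_square)
    moreover have "theta ((z + \<tau>) / \<tau>) (- 1 / \<tau>) = - theta (z / \<tau>) (- 1 / \<tau>)"
      using nz theta_plus_1[of "z / \<tau>"] by (simp add: add_divide_distrib)
    ultimately show ?thesis by (simp add: f_def)
  qed
  moreover have "f (z + 1) = - f z" for z
  proof -
    have "theta (z / \<tau>) (- 1 / \<tau>) = - nome (- (z + 1) / \<tau> + 1 / (2 * \<tau>)) * theta ((z + 1) / \<tau>) (- 1 / \<tau>)"
    proof -
      have "(z + 1) / \<tau> + - 1 / \<tau> = z / \<tau>" and "- ((z + 1) / \<tau>) - - 1 / \<tau> / 2 = - (z + 1) / \<tau> + 1 / (2 * \<tau>)"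
        using nz by (simp_all add: field_simps)
      thus ?thesis using theta_plus_tau[OF \<tau>', of "(z + 1) / \<tau>"] by (simp only:)
    qed
    hence "f z = - (nome (- z\<^sup>2 / (2 * \<tau>)) * nome (- (z + 1) / \<tau> + 1 / (2 * \<tau>))) * theta ((z + 1) / \<tau>) (- 1 / \<tau>)"
      by (simp add: f_def)
    also have "nome (- z\<^sup>2 / (2 * \<tau>)) * nome (- (z + 1) / \<tau> + 1 / (2 * \<tau>)) = nome (- (z + 1)\<^sup>2 / (2 * \<tau>))"
      unfolding nome_add[symmetric] using nz
      by (intro arg_cong[of _ _ nome]) (simp add: field_simps power2_eq_square)
    finally show ?thesis by (simp add: f_def)
  qed
  moreover have "f 0 = 0"
    unfolding f_def using theta_0[OF \<tau>'] by simp
  ultimately obtain C where C: "\<And>z. f z = C * theta z \<tau>"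
    using theta_unique[OF assms] by metis
  have "theta (z / \<tau>) (- 1 / \<tau>) = C * nome (z\<^sup>2 / (2 * \<tau>)) * theta z \<tau>" for z
  proof -
    have "nome (z\<^sup>2 / (2 * \<tau>)) * nome (- z\<^sup>2 / (2 * \<tau>)) = 1"
      by (simp add: nome_0 flip: nome_add)
    hence "theta (z / \<tau>) (- 1 / \<tau>) = nome (z\<^sup>2 / (2 * \<tau>)) * f z"
      unfolding f_def by (simp only: mult.assoc[symmetric] mult_1)
    thus ?thesis
      unfolding C by (simp only: mult_ac)
  qed
  thus ?thesis by (rule that)
qed

section \<open>Quadratic relations between theta values\<close>

lemma abs_summable_has_sum_times:
  fixes f :: "'a \<Rightarrow> complex" and g :: "'b \<Rightarrow> complex"
  assumes "(f has_sum a) A" "(g has_sum b) B"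
    and "(\<lambda>x. norm (f x)) summable_on A" "(\<lambda>y. norm (g y)) summable_on B"
  shows "((\<lambda>(x, y). f x * g y) has_sum (a * b)) (A \<times> B)"
proof (rule has_sum_SigmaI)
  show "((\<lambda>y. case (x, y) of (x, y) \<Rightarrow> f x * g y) has_sum f x * b) B" for x
    using has_sum_cmult_right[OF assms(2), of "f x"] by simp
  show "((\<lambda>x. f x * b) has_sum a * b) A"
    by (rule has_sum_cmult_left[OF assms(1)])
  have "(\<lambda>p. norm (case p of (x, y) \<Rightarrow> f x * g y)) summable_on (A \<times> B)"
    unfolding Infinite_Sum.abs_summable_on_Sigma_iff
    using assms(3,4)
    by (auto simp: norm_mult abs_mult infsum_cmult_right'
             intro!: summable_on_cmult_right summable_on_cmult_left)
  thus "(\<lambda>(x, y). f x * g y) summable_on (A \<times> B)"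
    by (rule abs_summable_summable)
qed

lemma theta_times_has_sum:
  assumes "Im \<tau> > 0" "Im \<sigma> > 0"
  shows "((\<lambda>(m, n). theta_term z \<tau> m * theta_term w \<sigma> n) has_sum (theta z \<tau> * theta w \<sigma>)) UNIV"
  using abs_summable_has_sum_times[OF theta_has_sum theta_has_sum theta_term_abs_summable theta_term_abs_summable, OF assms assms]
  by simp

lemma nome_eqI: "x = y + of_int k \<Longrightarrow> nome x = nome y"
  by (simp add: nome_add nome_of_int)

text \<open>
  The sums \<open>\<Sum> q^(s\<^sup>2/4) e(s x)\<close> over the even and over the odd integers \<open>s\<close>, expressed through theta
  with modulus \<open>2\<tau>\<close>.
\<close>
definition theta_even :: "complex \<Rightarrow> complex \<Rightarrow> complex" where
  "theta_even x \<tau> = nome (\<tau> / 4 + x - 1 / 4) * theta (2 * x + \<tau> - 1 / 2) (2 * \<tau>)"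

definition theta_odd :: "complex \<Rightarrow> complex \<Rightarrow> complex" where
  "theta_odd x \<tau> = nome (- 1 / 4) * theta (2 * x - 1 / 2) (2 * \<tau>)"

text \<open>
  In the double series for the left-hand side, take \<open>s = m + n - 1\<close> and \<open>t = m - n\<close> as new indices.
  They have opposite parity, and the two cases give the two terms on the right.
\<close>
lemma theta_addition:
  assumes "Im \<tau> > 0"
  shows "theta (x + y) \<tau> * theta (x - y) \<tau> =
           theta_odd x \<tau> * theta_even y \<tau> - theta_even x \<tau> * theta_odd y \<tau>"
proof -
  have \<tau>2: "Im (2 * \<tau>) > 0" using assms by simp
  define T where "T = (\<lambda>(m, n). theta_term (x + y) \<tau> m * theta_term (x - y) \<tau> n)"
  define c where "c = (\<lambda>z. nome (\<tau> / 4 + z - 1 / 4))"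
  define g where "g = (\<lambda>(z, w) (k, l). theta_term (2 * z + \<tau> - 1 / 2) (2 * \<tau>) k * theta_term (2 * w - 1 / 2) (2 * \<tau>) l)"
  have sum_g: "((\<lambda>kl. c z * nome (- 1 / 4) * g (z, w) kl) has_sum (theta_even z \<tau> * theta_odd w \<tau>)) UNIV" for z w
  proof -
    have "((\<lambda>kl. c z * nome (- 1 / 4) * g (z, w) kl) has_sum
       (c z * nome (- 1 / 4) * (theta (2 * z + \<tau> - 1 / 2) (2 * \<tau>) * theta (2 * w - 1 / 2) (2 * \<tau>)))) UNIV"
      unfolding g_def using theta_times_has_sum[OF \<tau>2 \<tau>2]
      by (intro has_sum_cmult_right) (simp add: case_prod_unfold)
    thus ?thesis by (simp add: theta_even_def theta_odd_def c_def mult_ac)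
  qed
  have odd: "(T has_sum - (theta_even x \<tau> * theta_odd y \<tau>)) {(m, n). odd (m + n)}"
  proof -
    have "bij_betw (\<lambda>(k, l). (k + l, k - l + 1)) UNIV {(m, n). odd (m + n :: int)}"
      by (rule bij_betwI[of _ _ _ "\<lambda>(m, n). ((m + n - 1) div 2, (m - n + 1) div 2)"])
         (auto elim!: oddE simp: algebra_simps)
    moreover have "T (k + l, k - l + 1) = - (c x * nome (- 1 / 4) * g (x, y) (k, l))" for k l
    proof -
      have "T (k + l, k - l + 1) = nome (1 / 2) * (c x * nome (- 1 / 4) * g (x, y) (k, l))"
        unfolding T_def g_def c_def theta_term_def split nome_add[symmetric]
        by (rule nome_eqI[of _ _ k]) (simp add: field_simps power2_eq_square)
      thus ?thesis by (simp add: nome_half)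
    qed
    hence "(\<lambda>kl. T (case kl of (k, l) \<Rightarrow> (k + l, k - l + 1))) = (\<lambda>kl. - (c x * nome (- 1 / 4) * g (x, y) kl))"
      by (auto simp: fun_eq_iff)
    ultimately show ?thesis
      using sum_g[of x y]
      by (subst has_sum_reindex_bij_betw[symmetric]) (auto simp: has_sum_uminus)
  qed
  have even: "(T has_sum (theta_even y \<tau> * theta_odd x \<tau>)) {(m, n). even (m + n)}"
  proof -
    have "bij_betw (\<lambda>(k, l). (k + l, l - k)) UNIV {(m, n). even (m + n :: int)}"
      by (rule bij_betwI[of _ _ _ "\<lambda>(m, n). ((m - n) div 2, (m + n) div 2)"])
         (auto elim!: evenE oddE simp: algebra_simps)
    moreover have "T (k + l, l - k) = c y * nome (- 1 / 4) * g (y, x) (k, l)" for k l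
      unfolding T_def g_def c_def theta_term_def split nome_add[symmetric]
      by (rule nome_eqI[of _ _ l]) (simp add: field_simps power2_eq_square)
    hence "(\<lambda>kl. T (case kl of (k, l) \<Rightarrow> (k + l, l - k))) = (\<lambda>kl. c y * nome (- 1 / 4) * g (y, x) kl)"
      by (auto simp: fun_eq_iff)
    ultimately show ?thesis
      using sum_g[of y x] by (subst has_sum_reindex_bij_betw[symmetric]) auto
  qed
  have "(T has_sum (- (theta_even x \<tau> * theta_odd y \<tau>) + theta_even y \<tau> * theta_odd x \<tau>)) 
          ({(m, n). odd (m + n)} \<union> {(m, n). even (m + n)})"
    by (rule has_sum_Un_disjoint[OF odd even]) auto
  also have "{(m, n). odd (m + n)} \<union> {(m, n). even (m + n)} = (UNIV :: (int \<times> int) set)"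
    by auto
  finally show ?thesis
    using theta_times_has_sum[OF assms assms, of "x + y" "x - y"] has_sum_unique unfolding T_def by fastforce
qed

text \<open>
  By the addition formula \<open>W x y\<close> is a 2 by 2 determinant with one column depending on \<open>x\<close> and
  the other on \<open>y\<close>, and this is the Pluecker relation between the six minors of a 2 by 4 matrix.
\<close>
lemma weierstrass_three_term:
  assumes "Im \<tau> > 0"
  defines "W \<equiv> \<lambda>x y. theta (x + y) \<tau> * theta (x - y) \<tau>"
  shows "W x y * W z w - W x z * W y w + W x w * W y z = 0"
  unfolding W_def theta_addition[OF assms(1)] by (simp add: algebra_simps)

text \<open>
  The Gaussian prefactor makes \<open>phi\<close> antiperiodic in \<open>k\<close> with period 13.  Up to powers of \<open>q\<close> and
  the factor \<open>(q^13; q^13)\<^sub>\<infinity>\<close>, it is the product of the \<open>1 - q^n\<close> over the positive \<open>n \<equiv> \<plusminus> k\<close> modulo 13.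
\<close>
definition phi :: "int \<Rightarrow> complex \<Rightarrow> complex" where
  "phi k \<tau> = nome (of_int k ^ 2 / 26 * \<tau>) * theta (of_int k * \<tau>) (13 * \<tau>)"

lemma phi_uminus: "Im \<tau> > 0 \<Longrightarrow> phi (- k) \<tau> = - phi k \<tau>"
  using theta_uminus[of "13 * \<tau>" "of_int k * \<tau>"] by (simp add: phi_def)

lemma phi_0: "Im \<tau> > 0 \<Longrightarrow> phi 0 \<tau> = 0"
  using theta_0[of "13 * \<tau>"] by (simp add: phi_def)

lemma phi_plus_13:
  assumes "Im \<tau> > 0"
  shows "phi (k + 13) \<tau> = - phi k \<tau>"
proof -
  have "theta (of_int (k + 13) * \<tau>) (13 * \<tau>) = - nome (- (of_int k * \<tau>) - 13 * \<tau> / 2) * theta (of_int k * \<tau>) (13 * \<tau>)"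
    using theta_plus_tau[of "13 * \<tau>" "of_int k * \<tau>"] assms by (simp add: algebra_simps)
  moreover have "nome (of_int (k + 13) ^ 2 / 26 * \<tau>) * nome (- (of_int k * \<tau>) - 13 * \<tau> / 2) = nome (of_int k ^ 2 / 26 * \<tau>)"
    unfolding nome_add[symmetric] by (rule arg_cong[of _ _ nome]) (simp add: field_simps power2_eq_square)
  ultimately show ?thesis
    unfolding phi_def by (simp only:) (simp add: mult_ac)
qed

text \<open>
  With \<open>M = m - 1/2\<close> and \<open>N = n - 1/2\<close> the double series runs over \<open>M + N i\<close> in the translate
  \<open>(1 + i)/2 + \<int>[i]\<close>, with exponent \<open>(M\<^sup>2 + N\<^sup>2)/2\<close> and character \<open>a (M + 5 N)\<close> modulo 13.  The
  substitution \<open>M + N i = (3 + 2 i) (M' + N' i) + c\<close> covers the translate once when \<open>c\<close> runs through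
  the residues modulo 13, and the character then depends on \<open>c\<close> alone.
\<close>
theorem theta_product_13:
  fixes a :: int
  assumes "Im \<tau> > 0"
  shows "theta (of_int a / 13) \<tau> * theta (of_int (5 * a) / 13) \<tau> =
           (\<Sum>c\<in>{0..<13}. nome (of_int c / 2 + of_int (a * c) / 13) * (phi (3 * c) \<tau> * phi (- 2 * c) \<tau>))"
proof -
  have \<tau>13: "Im (13 * \<tau>) > 0" using assms by simp
  define T where "T = (\<lambda>(m, n). theta_term (of_int a / 13) \<tau> m * theta_term (of_int (5 * a) / 13) \<tau> n)"
  define h :: "int \<times> int \<times> int \<Rightarrow> int \<times> int" where "h = (\<lambda>(c, k, l). (3 * k - 2 * l + c, 2 * k + 3 * l - 2))"
  define d where "d = (\<lambda>c::int. nome (of_int c / 2 + of_int (a * c) / 13) * nome (of_int (3 * c) ^ 2 / 26 * \<tau>) *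
                        nome (of_int (- 2 * c) ^ 2 / 26 * \<tau>))"
  \<comment> \<open>The inverse takes \<open>c\<close> from the residue of \<open>m + 5 n + 10\<close>, on which \<open>k\<close> and \<open>l\<close> act by multiples of 13.\<close>
  have bij: "bij_betw h ({0..<13} \<times> UNIV) UNIV"
  proof (rule bij_betwI[of _ _ _ "\<lambda>(m, n). let x = m + 5 * n + 10 in
           (x mod 13, 3 * (x div 13) - n - 2, n + 2 - 2 * (x div 13))"])
    fix x :: "int \<times> int \<times> int" assume "x \<in> {0..<13} \<times> UNIV"
    then obtain c k l where x: "x = (c, k, l)" "0 \<le> c" "c < 13"
      by (cases x) auto
    have "3 * k - 2 * l + c + 5 * (2 * k + 3 * l - 2) + 10 = 13 * (k + l) + c"
      by simp
    moreover have "(13 * (k + l) + c) div 13 = k + l" "(13 * (k + l) + c) mod 13 = c"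
      by (rule int_div_pos_eq int_mod_pos_eq, rule refl, rule x, rule x)+
    ultimately show "(case h x of (m, n) \<Rightarrow> let x = m + 5 * n + 10 in
           (x mod 13, 3 * (x div 13) - n - 2, n + 2 - 2 * (x div 13))) = x"
      by (simp add: x h_def Let_def)
  next
    fix x :: "int \<times> int"
    obtain m n where x: "x = (m, n)" by (cases x)
    define r c where "r = (m + 5 * n + 10) div 13" and "c = (m + 5 * n + 10) mod 13"
    have "13 * r + c = m + 5 * n + 10"
      unfolding r_def c_def by (rule mult_div_mod_eq)
    hence "h (c, 3 * r - n - 2, n + 2 - 2 * r) = x"
      by (simp add: h_def x)
    thus "h (case x of (m, n) \<Rightarrow> let x = m + 5 * n + 10 in
           (x mod 13, 3 * (x div 13) - n - 2, n + 2 - 2 * (x div 13))) = x"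
      by (simp add: x r_def c_def Let_def)
  qed (auto simp: Let_def)
  have T_h: "T (h (c, k, l)) = d c * (theta_term (of_int (3 * c) * \<tau>) (13 * \<tau>) k * theta_term (of_int (- 2 * c) * \<tau>) (13 * \<tau>) l)" for c k l
    unfolding T_def h_def d_def theta_term_def split nome_add[symmetric]
    by (rule nome_eqI[of _ _ "a * (k + l - 1) + 2 * k - 1"]) (simp add: field_simps power2_eq_square)
  have *: "((\<lambda>kl. T (h (c, kl))) has_sum d c * (theta (of_int (3 * c) * \<tau>) (13 * \<tau>) * theta (of_int (- 2 * c) * \<tau>) (13 * \<tau>))) UNIV" for c
  proof -
    have "(\<lambda>kl. T (h (c, kl))) = (\<lambda>kl. d c * (case kl of (k, l) \<Rightarrow>
            theta_term (of_int (3 * c) * \<tau>) (13 * \<tau>) k * theta_term (of_int (- 2 * c) * \<tau>) (13 * \<tau>) l))"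
      unfolding fun_eq_iff case_prod_unfold T_h[symmetric] prod.collapse by (rule allI refl)+
    thus ?thesis
      by (simp only:) (intro has_sum_cmult_right theta_times_has_sum \<tau>13)
  qed
  have "(T has_sum (theta (of_int a / 13) \<tau> * theta (of_int (5 * a) / 13) \<tau>)) UNIV"
    unfolding T_def by (rule theta_times_has_sum[OF assms assms])
  hence "((\<lambda>x. T (h x)) has_sum (theta (of_int a / 13) \<tau> * theta (of_int (5 * a) / 13) \<tau>)) ({0..<13} \<times> UNIV)"
    by (subst has_sum_reindex_bij_betw[OF bij])
  hence "((\<lambda>c. d c * (theta (of_int (3 * c) * \<tau>) (13 * \<tau>) * theta (of_int (- 2 * c) * \<tau>) (13 * \<tau>))) has_sum
           (theta (of_int a / 13) \<tau> * theta (of_int (5 * a) / 13) \<tau>)) {0..<13}"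
    by (rule has_sum_Sigma'[OF _ *])
  hence "(\<Sum>c\<in>{0..<13}. d c * (theta (of_int (3 * c) * \<tau>) (13 * \<tau>) * theta (of_int (- 2 * c) * \<tau>) (13 * \<tau>))) =
           theta (of_int a / 13) \<tau> * theta (of_int (5 * a) / 13) \<tau>"
    by (simp add: has_sum_finite_iff)
  thus ?thesis
    unfolding d_def phi_def by (simp only: mult_ac)
qed

section \<open>Products of 13-torsion values\<close>

text \<open>
  Both sides are polynomials in \<open>y\<close> of degree at most \<open>n\<close> that agree at \<open>n + 1\<close> points: the inverses
  of the roots of unity and 0.
\<close>
lemma prod_roots_of_unity:
  fixes c :: "'a \<Rightarrow> complex"
  assumes "finite R" "inj_on c R" "card R = n" "n > 0" "\<And>r. r \<in> R \<Longrightarrow> c r ^ n = 1"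
  shows "(\<Prod>r\<in>R. 1 - c r * y) = 1 - y ^ n"
proof -
  have nz: "c r \<noteq> 0" if "r \<in> R" for r
    using assms(4) assms(5)[OF that] by (auto simp: power_0_left)
  define A where "A = insert 0 ((\<lambda>r. inverse (c r)) ` R)"
  define p where "p = (\<Prod>r\<in>R. [:1, - c r:])"
  define p' where "p' = 1 - monom (1::complex) n"
  have "inj_on (\<lambda>r. inverse (c r)) R"
    using assms(2) by (auto simp: inj_on_def)
  hence "card ((\<lambda>r. inverse (c r)) ` R) = n"
    using assms(3) by (simp add: card_image)
  moreover have "0 \<notin> (\<lambda>r. inverse (c r)) ` R"
    using nz by auto
  ultimately have cardA: "card A = Suc n"
    using assms(1) by (simp add: A_def)
  have "p = p'"
  proof (rule poly_eqI_degree)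
    show "poly p x = poly p' x" if xA: "x \<in> A" for x
    proof (cases "x = 0")
      case True
      thus ?thesis using assms(4) by (simp add: p_def p'_def poly_prod poly_monom power_0_left)
    next
      case False
      then obtain r where r: "r \<in> R" "x = inverse (c r)"
        using xA unfolding A_def by auto
      have "poly p x = 0"
        using r assms(1) nz[OF r(1)] by (auto simp: p_def poly_prod intro!: bexI[of _ r])
      moreover have "poly p' x = 0"
        using r assms(5)[OF r(1)] by (simp add: p'_def poly_monom power_inverse)
      ultimately show ?thesis by simp
    qed
    have "degree p \<le> (\<Sum>r\<in>R. degree [:1, - c r:])"
      unfolding p_def by (rule order.trans[OF degree_prod_sum_le]) (use assms(1) in auto)
    also have "\<dots> \<le> (\<Sum>r\<in>R. 1)"
      by (intro sum_mono) auto
    finally show "degree p < card A"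
      using cardA assms(3) by simp
    have "degree p' \<le> n"
      unfolding p'_def by (intro degree_diff_le) (auto simp: degree_monom_le)
    thus "degree p' < card A"
      using cardA by simp
  qed
  hence "poly p y = poly p' y" by simp
  thus ?thesis by (simp add: p_def p'_def poly_prod poly_monom mult_ac)
qed

abbreviation root13 :: "int \<Rightarrow> complex" where
  "root13 k \<equiv> nome (of_int k / 13)"

lemma root13_add_mult: "root13 (k + 13 * j) = root13 k"
  by (rule nome_eqI[of _ _ j]) (simp add: field_simps)

text \<open>
  The signed sum over the subgroup \<open>{\<plusminus>1, \<plusminus>5}\<close> of the units modulo 13, for its quadratic character
  that is \<open>- 1\<close> at \<open>\<plusminus>5\<close>.  The sign appears because \<open>p0\<close>, \<open>p1\<close> and \<open>p2\<close> change sign when all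
  indices are multiplied by 5.
\<close>
definition sub_period :: "int \<Rightarrow> complex" where
  "sub_period a = root13 a + root13 (- a) - root13 (5 * a) - root13 (- 5 * a)"

lemma phi_reflect: "Im \<tau> > 0 \<Longrightarrow> phi (13 - k) \<tau> = phi k \<tau>"
  using phi_plus_13[of \<tau> "- k"] phi_uminus[of \<tau> k] by simp

lemma phi_four:
  assumes "a ^ 2 + b ^ 2 + c ^ 2 + d ^ 2 = N"
  shows "phi a \<tau> * phi b \<tau> * (phi c \<tau> * phi d \<tau>) = nome (of_int N / 26 * \<tau>) *
    (theta (of_int a * \<tau>) (13 * \<tau>) * theta (of_int b * \<tau>) (13 * \<tau>) *
    (theta (of_int c * \<tau>) (13 * \<tau>) * theta (of_int d * \<tau>) (13 * \<tau>)))"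
proof -
  have "nome (of_int N / 26 * \<tau>) = nome (of_int a ^ 2 / 26 * \<tau>) * nome (of_int b ^ 2 / 26 * \<tau>) * 
          (nome (of_int c ^ 2 / 26 * \<tau>) * nome (of_int d ^ 2 / 26 * \<tau>))"
    unfolding nome_add[symmetric] assms[symmetric]
    by (rule arg_cong[of _ _ nome]) (simp add: field_simps)
  thus ?thesis unfolding phi_def by (simp only: mult_ac)
qed

text \<open>
  Dividing by the product of all three terms, this reads \<open>1/p0 = 1/p1 + 1/p2\<close>.  It is the
  three-term relation at \<open>5\<tau>, \<tau>, 6\<tau>, 4\<tau>\<close>: the sums and differences of these arguments are,
  modulo 13 and up to sign, the required indices, and the Gaussian prefactors agree because
  the squares of the four indices add up to 156 in each term.
\<close>
lemma phi_relation:
  assumes "Im \<tau> > 0"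
  shows "(phi 2 \<tau> * phi 3 \<tau>) * (phi 4 \<tau> * phi 6 \<tau>) =
           (phi 1 \<tau> * phi 5 \<tau>) * (phi 2 \<tau> * phi 3 \<tau>) + (phi 1 \<tau> * phi 5 \<tau>) * (phi 4 \<tau> * phi 6 \<tau>)"
proof -
  let ?T = "\<lambda>k::int. theta (of_int k * \<tau>) (13 * \<tau>)"
  have "?T 6 * ?T 4 * (?T 10 * ?T 2) - ?T 11 * ?T (-1) * (?T 5 * ?T (-3)) + ?T 9 * ?T 1 * (?T 7 * ?T (-5)) = 0"
    using weierstrass_three_term[of "13 * \<tau>" "5 * \<tau>" \<tau> "6 * \<tau>" "4 * \<tau>"] assms
    by (simp add: algebra_simps)
  hence "nome (of_int 156 / 26 * \<tau>) * (?T 6 * ?T 4 * (?T 10 * ?T 2)) -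
         nome (of_int 156 / 26 * \<tau>) * (?T 11 * ?T (-1) * (?T 5 * ?T (-3))) +
         nome (of_int 156 / 26 * \<tau>) * (?T 9 * ?T 1 * (?T 7 * ?T (-5))) = 0"
    unfolding right_diff_distrib[symmetric] distrib_left[symmetric] by (simp only: mult_zero_right)
  hence "phi 6 \<tau> * phi 4 \<tau> * (phi 10 \<tau> * phi 2 \<tau>) -
         phi 11 \<tau> * phi (-1) \<tau> * (phi 5 \<tau> * phi (-3) \<tau>) +
         phi 9 \<tau> * phi 1 \<tau> * (phi 7 \<tau> * phi (-5) \<tau>) = 0"
    by (subst phi_four[of 6 4 10 2 156], simp, subst phi_four[of 11 "-1" 5 "-3" 156], simp,
        subst phi_four[of 9 1 7 "-5" 156], simp, assumption)
  moreover have "phi 10 \<tau> = phi 3 \<tau>" "phi 11 \<tau> = phi 2 \<tau>" "phi 9 \<tau> = phi 4 \<tau>" "phi 7 \<tau> = phi 6 \<tau>"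
    using phi_reflect[OF assms, of 3] phi_reflect[OF assms, of 2]
      phi_reflect[OF assms, of 4] phi_reflect[OF assms, of 6] by simp_all
  ultimately show ?thesis
    by (simp add: phi_uminus[OF assms] algebra_simps)
qed

text \<open>
  Collect the thirteen terms of \<open>theta_product_13\<close>: modulo 13 and up to sign, the pair \<open>(3 c, 2 c)\<close>
  is one of \<open>{1, 5}\<close>, \<open>{2, 3}\<close>, \<open>{4, 6}\<close>, and four values of \<open>c\<close> lead to each.  The term for
  \<open>c = 0\<close> vanishes.
\<close>
lemma theta_product_phi:
  assumes "Im \<tau> > 0"
  shows "theta (of_int a / 13) \<tau> * theta (of_int (5 * a) / 13) \<tau> =
           sub_period a * (phi 2 \<tau> * phi 3 \<tau>) - sub_period (2 * a) * (phi 4 \<tau> * phi 6 \<tau>)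
           - sub_period (4 * a) * (phi 1 \<tau> * phi 5 \<tau>)"
proof -
  define R where "R = (\<lambda>k::int. root13 (k * a))"
  define f where "f = (\<lambda>c. nome (of_int c / 2 + of_int (a * c) / 13) * (phi (3 * c) \<tau> * phi (- 2 * c) \<tau>))"
  have f: "f c = (if even c then 1 else - 1) * R c * (phi (3 * c) \<tau> * phi (- 2 * c) \<tau>)" for c
  proof (cases "even c")
    case True
    then obtain d where "c = 2 * d" by (elim evenE)
    thus ?thesis by (simp add: f_def R_def nome_add nome_of_int mult.commute)
  next
    case False
    then obtain d where "c = 2 * d + 1" by (elim oddE)
    moreover have "nome (of_int (2 * d + 1) / 2) = nome (1 / 2)"
      by (rule nome_eqI[of _ _ d]) (simp add: field_simps)
    ultimately show ?thesis by (simp add: f_def R_def nome_add nome_half mult.commute)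
  qed
  have sub: "sub_period (m * a) = R m + R (- m) - R (5 * m) - R (- 5 * m)" for m
    by (simp add: sub_period_def R_def mult.assoc)
  have R: "R (k + 13) = R k" for k
    unfolding R_def by (rule nome_eqI[of _ _ a]) (simp add: field_simps)
  have Rs: "R 7 = R (- 6)" "R 8 = R (- 5)" "R 9 = R (- 4)" "R 10 = R (- 3)" "R 11 = R (- 2)" "R 12 = R (- 1)"
     "R (- 10) = R 3" "R 20 = R (- 6)" "R (- 20) = R 6"
    using R[of "-6"] R[of "-5"] R[of "-4"] R[of "-3"] R[of "-2"] R[of "-1"] R[of "-10"] R[of 7] R[of "-20"] R[of "-7"]
    by simp_all
  have set: "{0..<13} = {0, 1, 2, 3, 4, 5, 6, 7, 8, 9, 10, 11, 12 :: int}"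
    by (rule set_eqI) (simp, presburger)
  have sum_f: "(\<Sum>c\<in>{0..<13}. f c) = f 0 + f 1 + f 2 + f 3 + f 4 + f 5 + f 6 + f 7 + f 8 + f 9 + f 10 + f 11 + f 12"
    unfolding set by simp
  have refl: "phi 7 \<tau> = phi 6 \<tau>" "phi 8 \<tau> = phi 5 \<tau>" "phi 9 \<tau> = phi 4 \<tau>"
      "phi 10 \<tau> = phi 3 \<tau>" "phi 11 \<tau> = phi 2 \<tau>" "phi 12 \<tau> = phi 1 \<tau>"
    using phi_reflect[OF assms, of 6] phi_reflect[OF assms, of 5] phi_reflect[OF assms, of 4]
      phi_reflect[OF assms, of 3] phi_reflect[OF assms, of 2] phi_reflect[OF assms, of 1] by simp_all
  have shift: "phi (k + 26) \<tau> = phi k \<tau>" for k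
    using phi_plus_13[OF assms, of k] phi_plus_13[OF assms, of "k + 13"] by (simp add: add.commute)
  have phis: "phi 14 \<tau> = - phi 1 \<tau>" "phi 15 \<tau> = - phi 2 \<tau>" "phi 16 \<tau> = - phi 3 \<tau>"
     "phi 18 \<tau> = - phi 5 \<tau>" "phi 20 \<tau> = - phi 6 \<tau>" "phi 21 \<tau> = - phi 5 \<tau>" "phi 22 \<tau> = - phi 4 \<tau>"
     "phi 24 \<tau> = - phi 2 \<tau>" "phi 27 \<tau> = phi 1 \<tau>" "phi 30 \<tau> = phi 4 \<tau>" "phi 33 \<tau> = phi 6 \<tau>" "phi 36 \<tau> = phi 3 \<tau>"
    using phi_plus_13[OF assms, of 1] phi_plus_13[OF assms, of 2] phi_plus_13[OF assms, of 3]
      phi_plus_13[OF assms, of 5] phi_plus_13[OF assms, of 7] phi_plus_13[OF assms, of 8]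
      phi_plus_13[OF assms, of 9] phi_plus_13[OF assms, of 11]
      shift[of 1] shift[of 4] shift[of 7] shift[of 10] by (simp_all add: refl)
  have "theta (of_int a / 13) \<tau> * theta (of_int (5 * a) / 13) \<tau> = (\<Sum>c\<in>{0..<13}. f c)"
    unfolding theta_product_13[OF assms] f_def ..
  also have "\<dots> = sub_period (1 * a) * (phi 2 \<tau> * phi 3 \<tau>) - sub_period (2 * a) * (phi 4 \<tau> * phi 6 \<tau>)
           - sub_period (4 * a) * (phi 1 \<tau> * phi 5 \<tau>)"
    unfolding sum_f unfolding f sub
    by (simp add: phi_uminus[OF assms] phi_0[OF assms] phis refl Rs algebra_simps)
  finally show ?thesis by simp
qed

section \<open>Cubic periods modulo 13\<close>

definition cos13 :: "int \<Rightarrow> complex" where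
  "cos13 k = root13 k + root13 (- k)"

lemma cos13_eq_cos: "cos13 k = of_real (2 * cos (2 * pi * of_int k / 13))"
proof -
  have "root13 k = cis (2 * pi * of_int k / 13)" for k
    unfolding cis_conv_exp nome_def by (rule arg_cong[of _ _ exp]) simp
  from this[of k] this[of "- k"] show ?thesis
    unfolding cos13_def by (simp add: complex_eq_iff)
qed

lemma cos13_mult: "cos13 a * cos13 b = cos13 (a + b) + cos13 (a - b)"
  by (simp add: cos13_def algebra_simps flip: nome_add add_divide_distrib)
    (simp add: add_divide_distrib diff_divide_distrib algebra_simps)

lemma cos13_cong: "cos13 (13 - k) = cos13 k" "cos13 (- k) = cos13 k" "cos13 0 = 2"
  using root13_add_mult[of "- k" 1] root13_add_mult[of "k" "-1"] by (simp_all add: cos13_def nome_0 add.commute)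

lemma cos13_less:
  assumes "0 \<le> a" "a < b" "b \<le> 6"
  shows "Re (cos13 b) < Re (cos13 a)"
proof -
  have "cos (2 * pi * of_int b / 13) < cos (2 * pi * of_int a / 13)"
    using assms by (intro cos_monotone_0_pi divide_strict_right_mono mult_strict_left_mono) (auto simp: field_simps)
  thus ?thesis by (simp add: cos13_eq_cos)
qed

lemma cos13_Im: "Im (cos13 k) = 0"
  by (simp add: cos13_eq_cos)

lemma cos13_products:
  "cos13 1 * cos13 1 = cos13 2 + 2" "cos13 1 * cos13 2 = cos13 3 + cos13 1" "cos13 1 * cos13 3 = cos13 4 + cos13 2"
  "cos13 1 * cos13 4 = cos13 5 + cos13 3" "cos13 1 * cos13 5 = cos13 6 + cos13 4" "cos13 1 * cos13 6 = cos13 6 + cos13 5"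
  "cos13 2 * cos13 2 = cos13 4 + 2" "cos13 2 * cos13 3 = cos13 5 + cos13 1" "cos13 2 * cos13 4 = cos13 6 + cos13 2"
  "cos13 2 * cos13 5 = cos13 6 + cos13 3" "cos13 2 * cos13 6 = cos13 5 + cos13 4"
  "cos13 3 * cos13 3 = cos13 6 + 2" "cos13 3 * cos13 4 = cos13 6 + cos13 1" "cos13 3 * cos13 5 = cos13 5 + cos13 2"
  "cos13 3 * cos13 6 = cos13 4 + cos13 3"
  "cos13 4 * cos13 4 = cos13 5 + 2" "cos13 4 * cos13 5 = cos13 4 + cos13 1" "cos13 4 * cos13 6 = cos13 3 + cos13 2"
  "cos13 5 * cos13 5 = cos13 3 + 2" "cos13 5 * cos13 6 = cos13 2 + cos13 1"
  "cos13 6 * cos13 5 = cos13 2 + cos13 1" "cos13 6 * cos13 6 = cos13 1 + 2"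
  using cos13_cong(1)[of 1] cos13_cong(1)[of 2] cos13_cong(1)[of 3] cos13_cong(1)[of 4] cos13_cong(1)[of 5] cos13_cong(1)[of 6]
    cos13_cong(2)[of 1] cos13_cong(2)[of 2] cos13_cong(2)[of 3] cos13_cong(2)[of 4] cos13_cong(2)[of 5]
  by (simp_all add: cos13_mult cos13_cong(3))

text \<open>
  Multiplication by a 13th root of unity fixes the sum \<open>S\<close> of all of them, so multiplication by
  \<open>cos13 1\<close>, a sum of two roots of unity, doubles it.
\<close>
lemma cos13_sum: "cos13 1 + cos13 2 + cos13 3 + cos13 4 + cos13 5 + cos13 6 = - 1"
proof -
  define S where "S = 1 + cos13 1 + cos13 2 + cos13 3 + cos13 4 + cos13 5 + cos13 6"
  have "cos13 1 * S = 2 * S"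
    unfolding S_def by (simp add: algebra_simps cos13_products)
  moreover have "cos13 1 \<noteq> 2"
    using cos13_less[of 0 1] cos13_cong(3) by auto
  ultimately have "S = 0" by simp
  thus ?thesis by (simp add: S_def add_eq_0_iff algebra_simps)
qed

lemma zeta13_powi: "zeta13 powi k = root13 k"
  using nome_power_int[of "1/13" k] by (simp add: zeta13_def nome_def)

lemma cubic_periods:
  "alpha13 = cos13 2 + cos13 3 - cos13 4 - cos13 6"
  "beta13 = cos13 1 + cos13 5 - cos13 4 - cos13 6"
  "gamma13 = cos13 2 + cos13 3 - cos13 1 - cos13 5"
  by (simp_all add: alpha13_def beta13_def gamma13_def cubic_period_def C0_def C1_def C2_def
        zeta13_powi cos13_def algebra_simps)

lemma sub_periods:
  "sub_period 1 = cos13 1 - cos13 5" "sub_period 2 = cos13 2 - cos13 3" "sub_period 4 = cos13 4 - cos13 6"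
  "sub_period 8 = - sub_period 1" "sub_period 16 = - sub_period 2"
  using root13_add_mult[of 3 "-1"] root13_add_mult[of "-3" 1] root13_add_mult[of 6 "-2"] root13_add_mult[of "-6" 2]
    root13_add_mult[of 5 "-1"] root13_add_mult[of "-5" 1] root13_add_mult[of 1 "-3"] root13_add_mult[of "-1" 3]
    root13_add_mult[of 3 1] root13_add_mult[of "-3" "-1"] root13_add_mult[of 2 6] root13_add_mult[of "-2" "-6"]
    root13_add_mult[of 5 "-1"] root13_add_mult[of 1 3] root13_add_mult[of "-1" "-3"]
    root13_add_mult[of 8 "-1"] root13_add_mult[of "-8" "1"] root13_add_mult[of 6 1] root13_add_mult[of "-6" "-1"]
  by (simp_all add: sub_period_def cos13_def)

text \<open>
  The quadratic Gauss sum modulo 13.  Its sign follows from the monotonicity of the cosine, by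
  pairing each residue with a larger non-residue.
\<close>
lemma gauss_sum_13: "cos13 1 + cos13 3 + cos13 4 - cos13 2 - cos13 5 - cos13 6 = of_real (sqrt 13)"
proof -
  define g where "g = cos13 1 + cos13 3 + cos13 4 - cos13 2 - cos13 5 - cos13 6"
  have "g * g = 13 - (cos13 1 + cos13 2 + cos13 3 + cos13 4 + cos13 5 + cos13 6 + 1)"
    unfolding g_def by (simp add: algebra_simps cos13_products)
  hence g2: "g * g = 13" by (simp add: cos13_sum)
  have g: "g = of_real (Re g)"
    by (simp add: g_def complex_eq_iff cos13_Im)
  hence "Re g * Re g = 13"
    using g2 by (metis of_real_eq_iff of_real_mult of_real_numeral)
  moreover have "Re g > 0"
    using cos13_less[of 1 2] cos13_less[of 3 5] cos13_less[of 4 6] by (simp add: g_def)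
  ultimately have "sqrt 13 = Re g"
    by (metis less_eq_real_def real_sqrt_abs2 abs_of_nonneg)
  thus ?thesis using g by (simp add: g_def)
qed

text \<open>
  The identities that make the forms \<open>L\<close> split: products of differences of cubic periods are,
  up to \<open>\<surd>13\<close>, the coefficients of \<open>L\<close>.  The last one is \<open>S13\<^sup>2 = I\<close>.
\<close>
lemma period_relations:
  "alpha13 = beta13 + gamma13"
  "alpha13 * beta13 = of_real (sqrt 13) * sub_period 1"
  "beta13 * gamma13 = of_real (sqrt 13) * sub_period 2"
  "alpha13 * gamma13 = of_real (sqrt 13) * sub_period 4"
  "gamma13 * gamma13 + alpha13 * beta13 = 13"
proof -
  have c6: "cos13 6 = - 1 - cos13 1 - cos13 2 - cos13 3 - cos13 4 - cos13 5"
    using cos13_sum by (simp add: algebra_simps eq_neg_iff_add_eq_0)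
  show "alpha13 = beta13 + gamma13"
    by (simp add: cubic_periods)
  show "alpha13 * beta13 = of_real (sqrt 13) * sub_period 1"
    "beta13 * gamma13 = of_real (sqrt 13) * sub_period 2"
    "alpha13 * gamma13 = of_real (sqrt 13) * sub_period 4"
    "gamma13 * gamma13 + alpha13 * beta13 = 13"
    unfolding gauss_sum_13[symmetric] cubic_periods sub_periods
    by (simp_all add: algebra_simps cos13_products) (simp_all add: c6)
qed

section \<open>Eta products\<close>

definition eta :: "complex \<Rightarrow> complex" where
  "eta \<tau> = nome (\<tau> / 24) * qpoch_inf (nome \<tau>) (nome \<tau>)"

lemma eta_nonzero: "Im \<tau> > 0 \<Longrightarrow> eta \<tau> \<noteq> 0"
  by (simp add: eta_def nome_nonzero qpoch_inf_self_nonzero norm_nome_less_1)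

text \<open>
  In the triple product for the three 2-torsion points everything except \<open>(q; q)\<^sub>\<infinity>\<^sup>3\<close> combines to
  a power of \<open>(- q; q)\<^sub>\<infinity> (q; q\<^sup>2)\<^sub>\<infinity>\<close>, which is 1 by Euler's identity.
\<close>
lemma theta_two_torsion:
  assumes "Im \<tau> > 0"
  shows "nome (\<tau> / 4) * (theta (1 / 2) \<tau> * theta (\<tau> / 2) \<tau> * theta ((1 + \<tau>) / 2) \<tau>) = - 2 * eta \<tau> ^ 3"
proof -
  let ?q = "nome \<tau>" and ?h = "nome (\<tau> / 2)"
  have q: "norm ?q < 1" using assms by (rule norm_nome_less_1)
  have q2: "norm (?q ^ 2) < 1" using q by (simp add: norm_power power_less_one_iff)
  have h: "?h ^ 2 = ?q" by (simp add: nome_power)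
  hence hq: "?q / ?h = ?h" by (simp add: power2_eq_square nome_nonzero field_simps)
  have sum: "nome ((1 + \<tau>) / 2) = - ?h" by (simp add: add_divide_distrib nome_add nome_half)
  have pair: "qpoch_inf a ?q * qpoch_inf (- a) ?q = qpoch_inf (a ^ 2) (?q ^ 2)" for a
    using qpoch_inf_prod_eq[OF q, of 2 "{1, - 1 :: complex}" "\<lambda>r. r" a]
    by (simp add: algebra_simps power2_eq_square)
  have split: "qpoch_inf ?q (?q ^ 2) * qpoch_inf (?q ^ 2) (?q ^ 2) = qpoch_inf ?q ?q"
    using qpoch_inf_prod_powers[OF q, of 2 ?q] by (simp add: numeral_2_eq_2)
  have "qpoch_inf (- ?q) ?q * qpoch_inf ?q (?q ^ 2) * (qpoch_inf ?q ?q * qpoch_inf (?q ^ 2) (?q ^ 2)) =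
          1 * (qpoch_inf ?q ?q * qpoch_inf (?q ^ 2) (?q ^ 2))"
    using pair[of ?q] split by (simp add: mult_ac)
  hence euler: "qpoch_inf (- ?q) ?q * qpoch_inf ?q (?q ^ 2) = 1"
    using qpoch_inf_self_nonzero[OF q] qpoch_inf_self_nonzero[OF q2] by simp
  have m1: "qpoch_inf (- 1) ?q = 2 * qpoch_inf (- ?q) ?q"
    using qpoch_inf_rec[OF q, of "- 1"] by simp
  have "nome (\<tau> / 4) * (theta (1 / 2) \<tau> * theta (\<tau> / 2) \<tau> * theta ((1 + \<tau>) / 2) \<tau>) =
     (nome (\<tau> / 4) * nome (\<tau> / 8 - 1 / 2 / 2) * nome (\<tau> / 8 - \<tau> / 2 / 2) * nome (\<tau> / 8 - (1 + \<tau>) / 2 / 2)) *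
     (qpoch_inf ?q ?q ^ 3 * 2 * (qpoch_inf (- ?q) ?q) ^ 2 * (qpoch_inf ?h ?q * qpoch_inf (- ?h) ?q) ^ 2)"
    unfolding theta_def jacobi_prod_def sum nome_half hq by (simp add: m1 hq power2_eq_square power3_eq_cube mult_ac)
  also have "qpoch_inf ?h ?q * qpoch_inf (- ?h) ?q = qpoch_inf ?q (?q ^ 2)"
    unfolding pair h ..
  also have "nome (\<tau> / 4) * nome (\<tau> / 8 - 1 / 2 / 2) * nome (\<tau> / 8 - \<tau> / 2 / 2) * nome (\<tau> / 8 - (1 + \<tau>) / 2 / 2) =
             nome (- (1 / 2)) * nome (\<tau> / 24) ^ 3"
    unfolding nome_power nome_add[symmetric] by (rule arg_cong[of _ _ nome]) (simp add: field_simps)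
  also have "nome (- (1 / 2)) = - 1"
    by (simp add: nome_minus nome_half)
  also have "qpoch_inf ?q ?q ^ 3 * 2 * qpoch_inf (- ?q) ?q ^ 2 * qpoch_inf ?q (?q ^ 2) ^ 2 =
             2 * qpoch_inf ?q ?q ^ 3 * (qpoch_inf (- ?q) ?q * qpoch_inf ?q (?q ^ 2)) ^ 2"
    by (simp add: power_mult_distrib mult_ac)
  finally show ?thesis
    unfolding euler eta_def by (simp add: power_mult_distrib)
qed

text \<open>
  Inversion permutes the three 2-torsion points, so the unknown constant \<open>C\<close> of
  \<open>theta_inversion\<close> is tied to eta.  The cube suffices, since only \<open>K^6\<close> has to be determined.
\<close>
lemma eta_inversion_cubed:
  assumes \<tau>: "Im \<tau> > 0"
    and C: "\<And>z. theta (z / \<tau>) (- 1 / \<tau>) = C * nome (z\<^sup>2 / (2 * \<tau>)) * theta z \<tau>"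
  shows "eta (- 1 / \<tau>) ^ 3 = nome (- (1 / 4)) * C ^ 3 * eta \<tau> ^ 3"
proof -
  define \<sigma> where "\<sigma> = - 1 / \<tau>"
  have nz: "\<tau> \<noteq> 0" using \<tau> by auto
  have \<sigma>: "Im \<sigma> > 0" unfolding \<sigma>_def by (rule Im_neg_inverse_pos[OF \<tau>])
  have 1: "theta (1 / 2) \<sigma> = C * nome (\<tau> / 8) * theta (\<tau> / 2) \<tau>"
    using C[of "\<tau> / 2"] nz by (simp add: \<sigma>_def power2_eq_square field_simps)
  have "theta (- (\<sigma> / 2)) \<sigma> = C * nome (1 / (8 * \<tau>)) * theta (1 / 2) \<tau>"
    using C[of "1 / 2"] nz by (simp add: \<sigma>_def power2_eq_square field_simps)
  hence 2: "theta (\<sigma> / 2) \<sigma> = - (C * nome (1 / (8 * \<tau>)) * theta (1 / 2) \<tau>)"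
    using theta_uminus[OF \<sigma>, of "\<sigma> / 2"] by (simp add: neg_eq_iff_add_eq_0 eq_neg_iff_add_eq_0)
  have half: "(1 + \<sigma>) / 2 = (\<tau> - 1) / 2 / \<tau>"
    using nz by (simp add: \<sigma>_def field_simps)
  have "theta ((1 + \<sigma>) / 2) \<sigma> = C * nome (((\<tau> - 1) / 2)\<^sup>2 / (2 * \<tau>)) * theta ((\<tau> - 1) / 2) \<tau>"
    unfolding half unfolding \<sigma>_def by (rule C)
  also have "theta ((\<tau> - 1) / 2) \<tau> = - theta ((1 + \<tau>) / 2) \<tau>"
    using theta_plus_1[of "(\<tau> - 1) / 2" \<tau>] by (simp add: field_simps)
  finally have 3: "theta ((1 + \<sigma>) / 2) \<sigma> = - (C * nome (((\<tau> - 1) / 2)\<^sup>2 / (2 * \<tau>)) * theta ((1 + \<tau>) / 2) \<tau>)"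
    by simp
  have "- 2 * eta \<sigma> ^ 3 = nome (\<sigma> / 4) * (theta (1 / 2) \<sigma> * theta (\<sigma> / 2) \<sigma> * theta ((1 + \<sigma>) / 2) \<sigma>)"
    by (rule theta_two_torsion[OF \<sigma>, symmetric])
  also have "\<dots> = C ^ 3 * (nome (\<sigma> / 4) * nome (\<tau> / 8) * nome (1 / (8 * \<tau>)) * nome (((\<tau> - 1) / 2)\<^sup>2 / (2 * \<tau>))) *
                    (theta (1 / 2) \<tau> * theta (\<tau> / 2) \<tau> * theta ((1 + \<tau>) / 2) \<tau>)"
    unfolding 1 2 3 by (simp add: power3_eq_cube mult_ac)
  also have "nome (\<sigma> / 4) * nome (\<tau> / 8) * nome (1 / (8 * \<tau>)) * nome (((\<tau> - 1) / 2)\<^sup>2 / (2 * \<tau>)) =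
             nome (- (1 / 4)) * nome (\<tau> / 4)"
    unfolding nome_add[symmetric] \<sigma>_def using nz
    by (intro arg_cong[of _ _ nome]) (simp add: field_simps power2_eq_square)
  also have "C ^ 3 * (nome (- (1 / 4)) * nome (\<tau> / 4)) * (theta (1 / 2) \<tau> * theta (\<tau> / 2) \<tau> * theta ((1 + \<tau>) / 2) \<tau>) =
     nome (- (1 / 4)) * C ^ 3 * (- 2 * eta \<tau> ^ 3)"
    unfolding theta_two_torsion[OF \<tau>, symmetric] by (simp only: mult_ac)
  finally show ?thesis unfolding \<sigma>_def by simp
qed

text \<open>
  Each \<open>theta (k/13)\<close> contains the factors belonging to the 13th roots of unity of index \<open>\<plusminus> k\<close>;
  together with one factor \<open>(q; q)\<^sub>\<infinity>\<close> for the root 1 they multiply to \<open>(q^13; q^13)\<^sub>\<infinity>\<close>.  The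
  constant \<open>\<kappa>\<close> does not depend on \<open>\<tau>\<close>, which is all that matters.
\<close>
lemma theta_prod_13_torsion:
  obtains \<kappa> where "\<kappa> \<noteq> 0" "\<And>\<tau>. Im \<tau> > 0 \<Longrightarrow> (\<Prod>k\<in>{1..6::int}. theta (of_int k / 13) \<tau>) = \<kappa> * eta \<tau> ^ 5 * eta (13 * \<tau>)"
proof
  define \<kappa> where "\<kappa> = (\<Prod>k\<in>{1..6::int}. nome (- of_int k / 26) * (1 - root13 k))"
  have ne1: "root13 k \<noteq> 1" if "\<not> 13 dvd k" for k
  proof
    assume "root13 k = 1"
    then obtain m where "of_int k / 13 = (of_int m :: complex)"
      by (auto simp: nome_eq_1_iff Ints_def)
    hence "of_int k = (of_int (13 * m) :: complex)" by (simp add: field_simps)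
    hence "k = 13 * m" by (simp only: of_int_eq_iff)
    thus False using that by simp
  qed
  have "\<not> 13 dvd k" if "k \<in> {1..6}" for k :: int
    using that zdvd_not_zless[of k 13] by auto
  thus "\<kappa> \<noteq> 0"
    using ne1 by (auto simp: \<kappa>_def nome_nonzero)
  fix \<tau> assume \<tau>: "Im \<tau> > 0"
  let ?q = "nome \<tau>"
  have q: "norm ?q < 1" using \<tau> by (rule norm_nome_less_1)
  have set: "{-6..6} = {0} \<union> ({1..6} \<union> uminus ` {1..6::int})"
    by (auto simp: image_iff)
  have neg: "prod g (uminus ` {1..6::int}) = (\<Prod>k\<in>{1..6}. g (- k))" for g :: "int \<Rightarrow> complex"
    by (subst prod.reindex) (auto simp: inj_on_def)
  have "(\<Prod>r\<in>{-6..6}. 1 - root13 r * y) = 1 - y ^ 13" for y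
  proof (rule prod_roots_of_unity)
    show "inj_on root13 {-6..6}"
    proof (rule inj_onI)
      fix k l :: int assume kl: "k \<in> {-6..6}" "l \<in> {-6..6}" "root13 k = root13 l"
      have "root13 (k - l) = 1"
        using kl(3) by (simp add: diff_divide_distrib nome_diff nome_nonzero)
      hence "13 dvd (k - l)" using ne1 by blast
      thus "k = l"
        using kl(1,2) unfolding atLeastAtMost_iff by presburger
    qed
    show "root13 r ^ 13 = 1" for r
      by (simp add: nome_power nome_of_int)
  qed auto
  hence "(\<Prod>r\<in>{-6..6}. qpoch_inf (root13 r * ?q) ?q) = qpoch_inf (?q ^ 13) (?q ^ 13)"
    by (intro qpoch_inf_prod_eq q) auto
  also have "(\<Prod>r\<in>{-6..6}. qpoch_inf (root13 r * ?q) ?q) =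
      qpoch_inf ?q ?q * ((\<Prod>k\<in>{1..6}. qpoch_inf (root13 k * ?q) ?q) * (\<Prod>k\<in>{1..6}. qpoch_inf (root13 (- k) * ?q) ?q))"
    unfolding set
    by (subst prod.union_disjoint, simp, simp, force, subst prod.union_disjoint, simp, simp, force)
       (simp only: neg, simp add: nome_0)
  finally have roots: "qpoch_inf ?q ?q * (\<Prod>k\<in>{1..6}. qpoch_inf (root13 k * ?q) ?q * qpoch_inf (root13 (- k) * ?q) ?q) =
      qpoch_inf (?q ^ 13) (?q ^ 13)"
    by (simp add: prod.distrib)
  have theta: "theta (of_int k / 13) \<tau> = (nome (- of_int k / 26) * (1 - root13 k)) * (nome (\<tau> / 8) * qpoch_inf ?q ?q) *
         (qpoch_inf (root13 k * ?q) ?q * qpoch_inf (root13 (- k) * ?q) ?q)" for k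
  proof -
    have "qpoch_inf (root13 k) ?q = (1 - root13 k) * qpoch_inf (root13 k * ?q) ?q"
      by (rule qpoch_inf_rec[OF q])
    moreover have "?q / root13 k = root13 (- k) * ?q"
      by (simp add: nome_minus field_simps)
    moreover have "nome (\<tau> / 8 - of_int k / 13 / 2) = nome (- of_int k / 26) * nome (\<tau> / 8)"
      unfolding nome_add[symmetric] by (rule arg_cong[of _ _ nome]) simp
    ultimately show ?thesis
      unfolding theta_def jacobi_prod_def by (simp only: mult_ac)
  qed
  have "(\<Prod>k\<in>{1..6::int}. theta (of_int k / 13) \<tau>) =
      \<kappa> * (nome (\<tau> / 8) * qpoch_inf ?q ?q) ^ 6 * 
       (\<Prod>k\<in>{1..6::int}. qpoch_inf (root13 k * ?q) ?q * qpoch_inf (root13 (- k) * ?q) ?q)"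
    unfolding theta \<kappa>_def by (simp add: prod.distrib)
  also have "\<dots> = \<kappa> * nome (\<tau> / 8) ^ 6 * qpoch_inf ?q ?q ^ 5 *
       (qpoch_inf ?q ?q * (\<Prod>k\<in>{1..6::int}. qpoch_inf (root13 k * ?q) ?q * qpoch_inf (root13 (- k) * ?q) ?q))"
    by (simp add: power_mult_distrib eval_nat_numeral mult_ac)
  also have "nome (\<tau> / 8) ^ 6 = nome (\<tau> / 24) ^ 5 * nome (13 * \<tau> / 24)"
    unfolding nome_power nome_add[symmetric] by (rule arg_cong[of _ _ nome]) simp
  finally show "(\<Prod>k\<in>{1..6::int}. theta (of_int k / 13) \<tau>) = \<kappa> * eta \<tau> ^ 5 * eta (13 * \<tau>)"
    unfolding roots eta_def by (simp add: nome_power[of \<tau>] power_mult_distrib mult_ac)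
qed

lemma phi_product:
  assumes "Im \<tau> > 0" "k \<le> 13"
  defines "q \<equiv> nome \<tau>"
  shows "phi (int k) \<tau> = nome (((of_nat k)\<^sup>2 / 26 - of_nat k / 2 + 13 / 8) * \<tau>) * qpoch_inf (q ^ 13) (q ^ 13) *
           (qpoch_inf (q ^ k) (q ^ 13) * qpoch_inf (q ^ (13 - k)) (q ^ 13))"
proof -
  have 1: "nome (of_int (int k) * \<tau>) = q ^ k" "nome (13 * \<tau>) = q ^ 13"
    by (simp_all add: q_def nome_power)
  have "q ^ 13 = q ^ (13 - k) * q ^ k"
    using assms(2) by (simp flip: power_add)
  hence 2: "q ^ 13 / q ^ k = q ^ (13 - k)"
    by (simp add: q_def nome_nonzero)
  have 3: "nome (((of_nat k)\<^sup>2 / 26 - of_nat k / 2 + 13 / 8) * \<tau>) =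
     nome (of_int (int k) ^ 2 / 26 * \<tau>) * nome (13 * \<tau> / 8 - of_int (int k) * \<tau> / 2)"
    unfolding nome_add[symmetric] by (rule arg_cong[of _ _ nome]) (simp add: field_simps)
  show ?thesis
    unfolding phi_def theta_def jacobi_prod_def 1 2 3 by (simp only: mult_ac)
qed

text \<open>
  The residue classes \<open>\<plusminus> 1, ..., \<plusminus> 6\<close>, together with the class 0, exhaust the residues modulo 13.
\<close>
lemma phi_prod:
  assumes "Im \<tau> > 0"
  shows "(\<Prod>k\<in>{1..6::int}. phi k \<tau>) = eta \<tau> * eta (13 * \<tau>) ^ 5"
proof -
  let ?q = "nome \<tau>"
  have q: "norm ?q < 1" using assms by (rule norm_nome_less_1)
  have set: "{1..6::int} = {1,2,3,4,5,6}" by (rule set_eqI) (simp, presburger)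
  have all: "qpoch_inf ?q ?q = (\<Prod>r<13. qpoch_inf (?q ^ Suc r) (?q ^ 13))"
    using qpoch_inf_prod_powers[OF q, of 13 ?q] by simp
  have P: "nome (1 / 24 * \<tau>) * nome (13 / 24 * \<tau>) ^ 5 =
      nome ((1\<^sup>2 / 26 - 1 / 2 + 13 / 8) * \<tau>) * nome ((2\<^sup>2 / 26 - 2 / 2 + 13 / 8) * \<tau>) *
      nome ((3\<^sup>2 / 26 - 3 / 2 + 13 / 8) * \<tau>) * nome ((4\<^sup>2 / 26 - 4 / 2 + 13 / 8) * \<tau>) *
      nome ((5\<^sup>2 / 26 - 5 / 2 + 13 / 8) * \<tau>) * nome ((6\<^sup>2 / 26 - 6 / 2 + 13 / 8) * \<tau>)"
    unfolding nome_power nome_add[symmetric] by (rule arg_cong[of _ _ nome]) (simp add: field_simps)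
  have "eta \<tau> * eta (13 * \<tau>) ^ 5 = (nome (1 / 24 * \<tau>) * nome (13 / 24 * \<tau>) ^ 5) *
          (qpoch_inf ?q ?q * qpoch_inf (?q ^ 13) (?q ^ 13) ^ 5)"
    by (simp add: eta_def nome_power power_mult_distrib)
  also have "\<dots> = (\<Prod>k\<in>{1..6::int}. phi k \<tau>)"
    using phi_product[OF assms, of 1] phi_product[OF assms, of 2] phi_product[OF assms, of 3]
      phi_product[OF assms, of 4] phi_product[OF assms, of 5] phi_product[OF assms, of 6]
    unfolding all set P by (simp add: lessThan_nat_numeral lessThan_Suc mult_ac power2_eq_square eval_nat_numeral)
  finally show ?thesis by simp
qed

lemma H_times_phi:
  assumes "Im \<tau> > 0"
  shows "H \<tau> $ 1 * (phi 1 \<tau> * phi 5 \<tau>) = eta (13 * \<tau>) ^ 2"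
    and "H \<tau> $ 2 * (phi 2 \<tau> * phi 3 \<tau>) = eta (13 * \<tau>) ^ 2"
proof -
  let ?q = "nome \<tau>" and ?Q = "nome \<tau> ^ 13"
  have Q: "norm ?Q < 1" using norm_nome_less_1[OF assms] by (simp add: norm_power power_less_one_iff)
  have nz: "qpoch_inf (?q ^ k) ?Q \<noteq> 0" if "k > 0" for k
  proof -
    have "norm (?q ^ k * ?Q ^ n) < 1" for n
      using norm_nome_less_1[OF assms] that power_less_one_iff[of "norm ?q" "k + 13 * n"]
      by (simp add: norm_mult norm_power power_add power_mult)
    hence "?q ^ k * ?Q ^ n \<noteq> 1" for n
      by (metis norm_one order_less_irrefl)
    thus ?thesis by (simp add: qpoch_inf_eq_0_iff[OF Q])
  qed
  have np: "nome_powr \<tau> (-(1/6)) = nome (- (\<tau> / 6))"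
    by (simp add: nome_powr_def nome_def mult_ac)
  have eta: "eta (13 * \<tau>) ^ 2 = nome (13 / 12 * \<tau>) * qpoch_inf ?Q ?Q ^ 2"
    by (simp add: eta_def power_mult_distrib nome_power)
  have e1: "nome (13 / 12 * \<tau>) = nome (- (1 / 6) * \<tau>) * (nome ((1\<^sup>2 / 26 - 1 / 2 + 13 / 8) * \<tau>) * nome ((5\<^sup>2 / 26 - 5 / 2 + 13 / 8) * \<tau>))"
    unfolding nome_add[symmetric] by (rule arg_cong[of _ _ nome]) (simp add: field_simps)
  have e2: "nome (13 / 12 * \<tau>) = nome (- (1 / 6) * \<tau>) * (nome ((2\<^sup>2 / 26 - 2 / 2 + 13 / 8) * \<tau>) * nome ((3\<^sup>2 / 26 - 3 / 2 + 13 / 8) * \<tau>))"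
    unfolding nome_add[symmetric] by (rule arg_cong[of _ _ nome]) (simp add: field_simps)
  show "H \<tau> $ 1 * (phi 1 \<tau> * phi 5 \<tau>) = eta (13 * \<tau>) ^ 2"
    unfolding eta e1
    using phi_product[OF assms, of 1] phi_product[OF assms, of 5] nz[of 1] nz[of 5] nz[of 8] nz[of 12]
    by (simp add: H_def P0_def qpochs_inf_def np field_simps power2_eq_square)
  show "H \<tau> $ 2 * (phi 2 \<tau> * phi 3 \<tau>) = eta (13 * \<tau>) ^ 2"
    unfolding eta e2
    using phi_product[OF assms, of 2] phi_product[OF assms, of 3] nz[of 2] nz[of 3] nz[of 10] nz[of 11]
    by (simp add: H_def P1_def qpochs_inf_def np field_simps power2_eq_square)
qed

section \<open>The Fricke involution\<close>

text \<open>
  With \<open>m = p1 - p0\<close> the relation between the \<open>p\<close> becomes \<open>m p2 = p0 p1\<close>, so \<open>m L0\<close>, \<open>m L1\<close>, \<open>m L2\<close> are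
  binary quadratic forms in \<open>p0\<close>, \<open>p1\<close>.  Each is \<open>- 1/s\<close> times the product of two of the linear
  forms \<open>l0\<close>, \<open>l1\<close>, \<open>l2\<close>.  The first claim says that \<open>L0 l0 = L1 l1\<close>, both sides being symmetric
  in the three forms; the second comes from multiplying the three factorizations.
\<close>
lemma fricke_algebra:
  fixes p0 p1 p2 d1 d2 d4 s al be ga :: complex
  assumes p: "p1 * p2 = p0 * p1 + p0 * p2" "p0 \<noteq> 0" "p1 \<noteq> 0"
    and s: "s \<noteq> 0" "al = be + ga" "al * be = s * d1" "be * ga = s * d2" "al * ga = s * d4"
  defines "L0 \<equiv> d1 * p1 - d2 * p2 - d4 * p0"
    and "L1 \<equiv> d2 * p1 - d4 * p2 + d1 * p0"
    and "L2 \<equiv> - (d4 * p1 + d1 * p2 + d2 * p0)"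
  shows "L0 * (ga * p1 + be * p0) = L1 * (al * p1 - ga * p0)"
    and "(L0 * (ga * p1 + be * p0)) ^ 2 * p2 = - s * (L0 * L1 * L2) * (p0 * p1)"
proof -
  define m where "m = p1 - p0"
  define l0 l1 l2 where "l0 = ga * p1 + be * p0" and "l1 = al * p1 - ga * p0" and "l2 = al * p0 - be * p1"
  have m: "m * p2 = p0 * p1"
    using p(1) by (simp add: m_def algebra_simps)
  hence m0: "m \<noteq> 0" using p by auto
  have A0: "s * L0 = al * be * p1 - be * ga * p2 - al * ga * p0"
    by (simp add: s(3-5) L0_def algebra_simps)
  have "s * m * L0 = (s * L0) * m"
    by simp
  also have "\<dots> = al * be * p1 * m - be * ga * (m * p2) - al * ga * p0 * m"
    unfolding A0 by (simp add: algebra_simps)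
  finally have F0: "s * m * L0 = - l1 * l2"
    unfolding m by (simp add: l1_def l2_def m_def s(2) algebra_simps)
  have A1: "s * L1 = be * ga * p1 - al * ga * p2 + al * be * p0"
    by (simp add: s(3-5) L1_def algebra_simps)
  have "s * m * L1 = (s * L1) * m"
    by simp
  also have "\<dots> = be * ga * p1 * m - al * ga * (m * p2) + al * be * p0 * m"
    unfolding A1 by (simp add: algebra_simps)
  finally have F1: "s * m * L1 = - l0 * l2"
    unfolding m by (simp add: l0_def l2_def m_def s(2) algebra_simps)
  have A2: "s * L2 = - (al * ga * p1 + al * be * p2 + be * ga * p0)"
    by (simp add: s(3-5) L2_def algebra_simps)
  have "s * m * L2 = (s * L2) * m"
    by simp
  also have "\<dots> = - (al * ga * p1 * m + al * be * (m * p2) + be * ga * p0 * m)"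
    unfolding A2 by (simp add: algebra_simps)
  finally have F2: "s * m * L2 = - l0 * l1"
    unfolding m by (simp add: l0_def l1_def m_def s(2) algebra_simps)
  have "(s * m * L0) * l0 = (s * m * L1) * l1"
    unfolding F0 F1 by simp
  thus "L0 * (ga * p1 + be * p0) = L1 * (al * p1 - ga * p0)"
    using m0 s(1) by (simp add: l0_def l1_def)
  have "(s * m) ^ 2 * ((L0 * l0) ^ 2 * p2) = ((s * m * L0) * l0) ^ 2 * p2"
    by (simp add: power2_eq_square)
  also have "\<dots> = - ((s * m * L0) * (s * m * L1) * (s * m * L2)) * p2"
    unfolding F0 F1 F2 by (simp add: power2_eq_square)
  also have "\<dots> = (s * m) ^ 2 * (- s * (L0 * L1 * L2) * (m * p2))"
    by (simp add: power2_eq_square)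
  finally have "(L0 * l0) ^ 2 * p2 = - s * (L0 * L1 * L2) * (m * p2)"
    by (rule mult_left_cancel[THEN iffD1, rotated]) (use m0 s(1) in simp)
  thus "(L0 * (ga * p1 + be * p0)) ^ 2 * p2 = - s * (L0 * L1 * L2) * (p0 * p1)"
    unfolding m l0_def .
qed

lemma phi_inversion:
  assumes \<tau>: "Im \<tau> > 0"
    and C: "\<And>z. theta (z / \<tau>) (- 1 / \<tau>) = C * nome (z\<^sup>2 / (2 * \<tau>)) * theta z \<tau>"
  shows "phi k (- 1 / (13 * \<tau>)) = - (C * theta (of_int k / 13) \<tau>)"
proof -
  have nz: "\<tau> \<noteq> 0" using \<tau> by auto
  have args: "of_int k * (- 1 / (13 * \<tau>)) = (- (of_int k / 13)) / \<tau>" "13 * (- 1 / (13 * \<tau>)) = - 1 / \<tau>"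
    using nz by (simp_all add: field_simps)
  have "nome (of_int k ^ 2 / 26 * (- 1 / (13 * \<tau>))) * nome ((- (of_int k / 13))\<^sup>2 / (2 * \<tau>)) = nome 0"
    unfolding nome_add[symmetric] using nz
    by (intro arg_cong[of _ _ nome]) (simp add: field_simps power2_eq_square)
  thus ?thesis
    unfolding phi_def args C theta_uminus[OF \<tau>] by (simp add: nome_0 mult_ac)
qed

lemma phi_nonzero:
  assumes "Im \<tau> > 0" "k \<in> {1..6}"
  shows "phi k \<tau> \<noteq> 0"
proof -
  have "(\<Prod>k\<in>{1..6::int}. phi k \<tau>) \<noteq> 0"
    unfolding phi_prod[OF assms(1)] using assms(1) by (simp add: eta_nonzero)
  thus ?thesis using assms(2) by auto
qed

text \<open>
  The arguments \<open>10/13\<close> and \<open>20/13\<close>, which \<open>theta_product_phi\<close> produces for \<open>a = 2\<close> and \<open>a = 4\<close>, are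
  reflected to \<open>3/13\<close> and \<open>6/13\<close>, so that all six torsion values occur once.
\<close>
lemma theta_products:
  assumes "Im \<tau> > 0"
  shows "theta (1 / 13) \<tau> * theta (5 / 13) \<tau> = sub_period 1 * (phi 2 \<tau> * phi 3 \<tau>) -
            sub_period 2 * (phi 4 \<tau> * phi 6 \<tau>) - sub_period 4 * (phi 1 \<tau> * phi 5 \<tau>)"
    and "theta (2 / 13) \<tau> * theta (3 / 13) \<tau> = sub_period 2 * (phi 2 \<tau> * phi 3 \<tau>) -
            sub_period 4 * (phi 4 \<tau> * phi 6 \<tau>) + sub_period 1 * (phi 1 \<tau> * phi 5 \<tau>)"
    and "theta (4 / 13) \<tau> * theta (6 / 13) \<tau> = - (sub_period 4 * (phi 2 \<tau> * phi 3 \<tau>) +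
            sub_period 1 * (phi 4 \<tau> * phi 6 \<tau>) + sub_period 2 * (phi 1 \<tau> * phi 5 \<tau>))"
proof -
  have refl: "theta (1 - z) \<tau> = theta z \<tau>" for z
    using theta_plus_1[of "- z" \<tau>] theta_uminus[OF assms, of z] by simp
  have "theta (10 / 13) \<tau> = theta (3 / 13) \<tau>" "theta (20 / 13) \<tau> = - theta (6 / 13) \<tau>"
    using refl[of "3 / 13"] refl[of "6 / 13"] theta_plus_1[of "7 / 13" \<tau>] by simp_all
  thus "theta (1 / 13) \<tau> * theta (5 / 13) \<tau> = sub_period 1 * (phi 2 \<tau> * phi 3 \<tau>) -
            sub_period 2 * (phi 4 \<tau> * phi 6 \<tau>) - sub_period 4 * (phi 1 \<tau> * phi 5 \<tau>)"
    "theta (2 / 13) \<tau> * theta (3 / 13) \<tau> = sub_period 2 * (phi 2 \<tau> * phi 3 \<tau>) -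
            sub_period 4 * (phi 4 \<tau> * phi 6 \<tau>) + sub_period 1 * (phi 1 \<tau> * phi 5 \<tau>)"
    "theta (4 / 13) \<tau> * theta (6 / 13) \<tau> = - (sub_period 4 * (phi 2 \<tau> * phi 3 \<tau>) +
            sub_period 1 * (phi 4 \<tau> * phi 6 \<tau>) + sub_period 2 * (phi 1 \<tau> * phi 5 \<tau>))"
    using theta_product_phi[OF assms, of 1] theta_product_phi[OF assms, of 2] theta_product_phi[OF assms, of 4]
    by (simp_all add: sub_periods(4,5) algebra_simps minus_equation_iff[of "theta (4 / 13) \<tau> * _"])
qed

text \<open>
  Inversion carries \<open>p0\<close>, \<open>p1\<close> to \<open>C\<^sup>2 L0\<close>, \<open>C\<^sup>2 L1\<close>, and \<open>fricke_algebra\<close> turns the reciprocals of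
  these into the required linear forms in \<open>1/p0\<close>, \<open>1/p1\<close>.  The square of the remaining scalar is,
  up to a constant, the fourth power of \<open>eta (- 1/\<tau>) / (C eta \<tau>)\<close>, and the cube of this quotient
  is constant.
\<close>
lemma fricke_up_to_scalar:
  obtains k where "\<And>\<tau>. Im \<tau> > 0 \<Longrightarrow> \<exists>K. K ^ 6 = k \<and>
    H (- 1 / (13 * \<tau>)) $ 1 = K * (gamma13 * H \<tau> $ 1 + beta13 * H \<tau> $ 2) \<and>
    H (- 1 / (13 * \<tau>)) $ 2 = K * (alpha13 * H \<tau> $ 1 - gamma13 * H \<tau> $ 2)"
proof -
  obtain \<kappa> where \<kappa>: "\<kappa> \<noteq> 0"
      "\<And>\<tau>. Im \<tau> > 0 \<Longrightarrow> (\<Prod>k\<in>{1..6::int}. theta (of_int k / 13) \<tau>) = \<kappa> * eta \<tau> ^ 5 * eta (13 * \<tau>)"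
    using theta_prod_13_torsion by blast
  define s where "s = complex_of_real (sqrt 13)"
  have s: "s \<noteq> 0" by (simp add: s_def)
  have "\<exists>K. K ^ 6 = - 1 / (s * \<kappa>) ^ 3 \<and>
    H (- 1 / (13 * \<tau>)) $ 1 = K * (gamma13 * H \<tau> $ 1 + beta13 * H \<tau> $ 2) \<and>
    H (- 1 / (13 * \<tau>)) $ 2 = K * (alpha13 * H \<tau> $ 1 - gamma13 * H \<tau> $ 2)" if \<tau>: "Im \<tau> > 0" for \<tau>
  proof -
    define \<sigma> where "\<sigma> = - 1 / (13 * \<tau>)"
    have \<sigma>: "Im \<sigma> > 0"
      unfolding \<sigma>_def by (rule Im_neg_inverse_pos) (use \<tau> in simp)
    have \<sigma>13: "13 * \<sigma> = - 1 / \<tau>"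
      by (simp add: \<sigma>_def)
    obtain C where C: "\<And>z. theta (z / \<tau>) (- 1 / \<tau>) = C * nome (z\<^sup>2 / (2 * \<tau>)) * theta z \<tau>"
      using theta_inversion[OF \<tau>] by blast
    have set: "{1..6::int} = {1,2,3,4,5,6}" by (rule set_eqI) (simp, presburger)
    define p0 p1 p2 where "p0 = phi 1 \<tau> * phi 5 \<tau>" and "p1 = phi 2 \<tau> * phi 3 \<tau>" and "p2 = phi 4 \<tau> * phi 6 \<tau>"
    define L0 L1 L2 where
      "L0 = sub_period 1 * p1 - sub_period 2 * p2 - sub_period 4 * p0"
      and "L1 = sub_period 2 * p1 - sub_period 4 * p2 + sub_period 1 * p0"
      and "L2 = - (sub_period 4 * p1 + sub_period 1 * p2 + sub_period 2 * p0)"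
    define e e' e13 where "e = eta \<tau>" and "e' = eta (- 1 / \<tau>)" and "e13 = eta (13 * \<tau>)"
    have nz: "p0 \<noteq> 0" "p1 \<noteq> 0" "p2 \<noteq> 0"
      using phi_nonzero[OF \<tau>] by (simp_all add: p0_def p1_def p2_def)
    have nze: "e \<noteq> 0" "e' \<noteq> 0" "e13 \<noteq> 0"
      unfolding e_def e'_def e13_def
      by (rule eta_nonzero, use \<tau> Im_neg_inverse_pos[OF \<tau>] in simp)+
    have \<sigma>p: "phi 1 \<sigma> * phi 5 \<sigma> = C ^ 2 * L0" "phi 2 \<sigma> * phi 3 \<sigma> = C ^ 2 * L1"
      using theta_products(1,2)[OF \<tau>] phi_inversion[OF \<tau> C, of 1] phi_inversion[OF \<tau> C, of 5]
        phi_inversion[OF \<tau> C, of 2] phi_inversion[OF \<tau> C, of 3]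
      unfolding \<sigma>_def[symmetric] L0_def L1_def p0_def p1_def p2_def by (simp_all add: power2_eq_square)
    have nzL: "L0 \<noteq> 0" "L1 \<noteq> 0" "C \<noteq> 0"
      using phi_nonzero[OF \<sigma>, of 1] phi_nonzero[OF \<sigma>, of 5] phi_nonzero[OF \<sigma>, of 2] phi_nonzero[OF \<sigma>, of 3] \<sigma>p by auto
    have prodL: "L0 * L1 * L2 = \<kappa> * e ^ 5 * e13"
    proof -
      have L: "L0 = theta (1 / 13) \<tau> * theta (5 / 13) \<tau>" "L1 = theta (2 / 13) \<tau> * theta (3 / 13) \<tau>"
          "L2 = theta (4 / 13) \<tau> * theta (6 / 13) \<tau>"
        unfolding theta_products[OF \<tau>] L0_def L1_def L2_def p0_def p1_def p2_def by (rule refl)+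
      have "L0 * L1 * L2 = (\<Prod>k\<in>{1..6::int}. theta (of_int k / 13) \<tau>)"
        unfolding set L by (simp add: mult_ac)
      thus ?thesis using \<kappa>(2)[OF \<tau>] by (simp add: e_def e13_def)
    qed
    have prodp: "p0 * p1 * p2 = e * e13 ^ 5"
      using phi_prod[OF \<tau>] unfolding set p0_def p1_def p2_def e_def e13_def by (simp add: mult_ac)
    define X where "X = L0 * (gamma13 * p1 + beta13 * p0)"
    have "p1 * p2 = p0 * p1 + p0 * p2"
      unfolding p0_def p1_def p2_def by (rule phi_relation[OF \<tau>])
    from fricke_algebra[OF this nz(1,2) s period_relations(1-4)[folded s_def]]
    have X: "X = L1 * (alpha13 * p1 - gamma13 * p0)" and X2: "X ^ 2 * p2 = - s * (L0 * L1 * L2) * (p0 * p1)"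
      unfolding X_def L0_def L1_def L2_def by simp_all
    have nzX: "X \<noteq> 0"
      using X2 s nz nze \<kappa>(1) unfolding prodL by auto
    have H: "H \<tau> $ 1 = e13 ^ 2 / p0" "H \<tau> $ 2 = e13 ^ 2 / p1"
      using H_times_phi[OF \<tau>] nz unfolding e13_def p0_def[symmetric] p1_def[symmetric] by (simp_all add: field_simps)
    have H': "H \<sigma> $ 1 = e' ^ 2 / (C ^ 2 * L0)" "H \<sigma> $ 2 = e' ^ 2 / (C ^ 2 * L1)"
      using H_times_phi[OF \<sigma>] nzL unfolding \<sigma>13 e'_def \<sigma>p by (simp_all add: field_simps)
    define K where "K = e' ^ 2 * p0 * p1 / (C ^ 2 * e13 ^ 2 * X)"
    have "K * (gamma13 * H \<tau> $ 1 + beta13 * H \<tau> $ 2) = e' ^ 2 * (gamma13 * p1 + beta13 * p0) / (C ^ 2 * X)"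
      unfolding K_def H using nz nze nzL nzX by (simp add: divide_simps) (simp add: algebra_simps)
    also have "\<dots> = H \<sigma> $ 1"
      using nzX unfolding H' X_def mult.assoc[symmetric]
      by (intro nonzero_mult_divide_mult_cancel_right) auto
    finally have 1: "H \<sigma> $ 1 = K * (gamma13 * H \<tau> $ 1 + beta13 * H \<tau> $ 2)" ..
    have "K * (alpha13 * H \<tau> $ 1 - gamma13 * H \<tau> $ 2) = e' ^ 2 * (alpha13 * p1 - gamma13 * p0) / (C ^ 2 * X)"
      unfolding K_def H using nz nze nzL nzX by (simp add: divide_simps) (simp add: algebra_simps)
    also have "\<dots> = H \<sigma> $ 2"
      using nzX unfolding H' X mult.assoc[symmetric]
      by (intro nonzero_mult_divide_mult_cancel_right) auto
    finally have 2: "H \<sigma> $ 2 = K * (alpha13 * H \<tau> $ 1 - gamma13 * H \<tau> $ 2)" ..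
    have "K ^ 2 * (X ^ 2 * p2) = e' ^ 4 * (p0 * p1 * p2) * (p0 * p1) / (C ^ 4 * e13 ^ 4)"
      unfolding K_def using nzX
      by (simp add: power_divide power_mult_distrib field_simps flip: power_mult) (simp add: power2_eq_square)
    hence "K ^ 2 * (- s * \<kappa>) * (e ^ 5 * e13 * (p0 * p1)) = (e' ^ 4 / (C ^ 4 * e ^ 4)) * (e ^ 5 * e13 * (p0 * p1))"
      unfolding X2 prodL prodp using nze by (simp add: field_simps eval_nat_numeral)
    hence "K ^ 2 * (- s * \<kappa>) = e' ^ 4 / (C ^ 4 * e ^ 4)"
      by (rule mult_right_cancel[THEN iffD1, rotated]) (use nz nze in simp)
    hence "(K ^ 2 * (- s * \<kappa>)) ^ 3 = (e' ^ 4 / (C ^ 4 * e ^ 4)) ^ 3" by simp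
    also have "\<dots> = (e' ^ 3 / (C ^ 3 * e ^ 3)) ^ 4"
      by (simp add: power_divide power_mult_distrib flip: power_mult)
    also have "e' ^ 3 / (C ^ 3 * e ^ 3) = nome (- (1 / 4))"
      using eta_inversion_cubed[OF \<tau> C] nzL nze unfolding e_def e'_def by (simp add: field_simps)
    also have "nome (- (1 / 4)) ^ 4 = 1"
      using nome_of_int[of "-1"] by (simp add: nome_power)
    also have "(K ^ 2 * (- s * \<kappa>)) ^ 3 = - (K ^ 6 * (s * \<kappa>) ^ 3)"
      by (simp add: power_mult_distrib flip: power_mult)
    finally have "- (K ^ 6 * (s * \<kappa>) ^ 3) = 1" .
    hence "K ^ 6 * (s * \<kappa>) ^ 3 = - 1"
      by (metis minus_minus)
    hence "K ^ 6 = - 1 / (s * \<kappa>) ^ 3"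
      using s \<kappa>(1) by (subst nonzero_eq_divide_eq) auto
    thus ?thesis using 1 2 unfolding \<sigma>_def by blast
  qed
  thus ?thesis by (rule that)
qed

lemma H_continuous: "continuous_on {\<tau>. Im \<tau> > 0} (\<lambda>\<tau>. H \<tau> $ 1)" "continuous_on {\<tau>. Im \<tau> > 0} (\<lambda>\<tau>. H \<tau> $ 2)"
proof -
  let ?U = "{\<tau>. Im \<tau> > 0}"
  have U: "open ?U" by (rule open_halfspace_Im_gt)
  have phi: "phi k holomorphic_on ?U" for k
    unfolding phi_def by (intro holomorphic_intros theta_holomorphic U) auto
  have eta: "(\<lambda>\<tau>. eta (13 * \<tau>)) holomorphic_on ?U"
    unfolding eta_def by (intro holomorphic_intros qpoch_inf_holomorphic U) (auto intro!: norm_nome_less_1)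
  have "(\<lambda>\<tau>. eta (13 * \<tau>) ^ 2 / (phi 1 \<tau> * phi 5 \<tau>)) holomorphic_on ?U"
    by (intro holomorphic_intros phi eta) (simp add: phi_nonzero)
  hence 1: "(\<lambda>\<tau>. H \<tau> $ 1) holomorphic_on ?U"
    by (rule holomorphic_transform) (use H_times_phi(1) in \<open>auto simp: phi_nonzero field_simps\<close>)
  have "(\<lambda>\<tau>. eta (13 * \<tau>) ^ 2 / (phi 2 \<tau> * phi 3 \<tau>)) holomorphic_on ?U"
    by (intro holomorphic_intros phi eta) (simp add: phi_nonzero)
  hence 2: "(\<lambda>\<tau>. H \<tau> $ 2) holomorphic_on ?U"
    by (rule holomorphic_transform) (use H_times_phi(2) in \<open>auto simp: phi_nonzero field_simps\<close>)
  show "continuous_on ?U (\<lambda>\<tau>. H \<tau> $ 1)" "continuous_on ?U (\<lambda>\<tau>. H \<tau> $ 2)"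
    by (rule holomorphic_on_imp_continuous_on[OF 1] holomorphic_on_imp_continuous_on[OF 2])+
qed

lemma H_nonzero: "Im \<tau> > 0 \<Longrightarrow> H \<tau> $ 1 \<noteq> 0"
  using H_times_phi(1)[of \<tau>] eta_nonzero[of "13 * \<tau>"] by auto

lemma qpoch_inf_pos:
  assumes "0 \<le> a" "a < 1" "0 \<le> r" "r < 1"
  obtains x where "x > 0" "qpoch_inf (of_real a) (of_real r) = of_real x"
proof -
  have r: "norm (complex_of_real r) < 1" using assms by simp
  have nonneg: "(\<Prod>n<N. 1 - a * r ^ n) \<ge> 0" and lt: "a * r ^ n < 1" for N n
  proof -
    have *: "a * r ^ n < 1" for n
      using mult_left_mono[of "r ^ n" 1 a] assms power_le_one[of r n] by simp
    show "a * r ^ n < 1" by (rule *)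
    show "(\<Prod>n<N. 1 - a * r ^ n) \<ge> 0"
      by (intro prod_nonneg) (use * in \<open>auto intro: less_imp_le\<close>)
  qed
  have lim: "(\<lambda>N. of_real (\<Prod>n<N. 1 - a * r ^ n)) \<longlonglongrightarrow> qpoch_inf (of_real a) (of_real r)"
    using qpoch_inf_LIMSEQ[OF r, of "of_real a"] by simp
  have im: "Im (qpoch_inf (of_real a) (of_real r)) = 0"
    using tendsto_Im[OF lim] unfolding Im_complex_of_real by (simp add: LIMSEQ_const_iff)
  have re: "Re (qpoch_inf (of_real a) (of_real r)) \<ge> 0"
    using LIMSEQ_le_const[OF tendsto_Re[OF lim, unfolded Re_complex_of_real]] nonneg by blast
  have "complex_of_real a * of_real r ^ n \<noteq> 1" for n
    using lt[of n] by (metis less_irrefl of_real_1 of_real_eq_iff of_real_mult of_real_power)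
  hence "qpoch_inf (of_real a) (of_real r) \<noteq> 0"
    by (simp add: qpoch_inf_eq_0_iff[OF r])
  hence "Re (qpoch_inf (of_real a) (of_real r)) \<noteq> 0"
    using im by (auto simp: complex_eq_iff)
  with re im show ?thesis
    by (intro that[of "Re (qpoch_inf (of_real a) (of_real r))"]) (auto simp: complex_eq_iff)
qed

lemma H_imaginary_axis:
  assumes "t > 0"
  obtains x y where "x > 0" "y > 0" "H (of_real t * \<i>) $ 1 = of_real x" "H (of_real t * \<i>) $ 2 = of_real y"
proof -
  define r where "r = exp (- (2 * pi * t))"
  have r: "0 < r" "r < 1" using assms by (auto simp: r_def)
  have nome: "nome (of_real t * \<i>) = of_real r"
    by (simp add: nome_def r_def exp_of_real[symmetric] mult_ac del: exp_of_real)
  have np: "nome_powr (of_real t * \<i>) b = of_real (exp (- (2 * pi * b * t)))" for b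
    by (simp add: nome_powr_def exp_of_real[symmetric] mult_ac del: exp_of_real)
  have "\<exists>x>0. qpoch_inf (of_real r ^ k) (of_real r ^ 13) = of_real x" if "k > 0" for k
  proof -
    have "r ^ k < 1" using r that by (simp add: power_less_one_iff)
    moreover have "r ^ 13 < 1" using r by (simp add: power_less_one_iff)
    ultimately show ?thesis
      using qpoch_inf_pos[of "r ^ k" "r ^ 13"] r by (metis less_imp_le of_real_power zero_less_power)
  qed
  then obtain f where f: "\<And>k. k > 0 \<Longrightarrow> f k > 0 \<and> qpoch_inf (of_real r ^ k) (of_real r ^ 13) = of_real (f k)"
    by metis
  note f1 = f[of 1, simplified]
  have "H (of_real t * \<i>) $ 1 = of_real (exp (- (2 * pi * (- 1 / 6) * t)) * inverse (f 1 * (f 5 * (f 8 * f 12))))"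
       "H (of_real t * \<i>) $ 2 = of_real (exp (- (2 * pi * (- 1 / 6) * t)) * inverse (f 2 * (f 3 * (f 10 * f 11))))"
    unfolding H_def nome np P0_def P1_def qpochs_inf_def by (simp_all add: f f1)
  moreover have "exp (- (2 * pi * (- 1 / 6) * t)) * inverse (f 1 * (f 5 * (f 8 * f 12))) > 0"
      "exp (- (2 * pi * (- 1 / 6) * t)) * inverse (f 2 * (f 3 * (f 10 * f 11))) > 0"
    by (intro mult_pos_pos; simp add: f f1)+
  ultimately show ?thesis using that by blast
qed

text \<open>
  The scalar \<open>K\<close> is continuous and takes finitely many values, so it is a constant \<open>c\<close>.  Applying the
  transformation twice at the fixed point gives \<open>13 c\<^sup>2 = 1\<close>, and the negative root is excluded
  because \<open>\<beta> > 0\<close> and \<open>\<gamma> > - \<surd>13\<close> while both entries of \<open>H\<close> are positive.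
\<close>
theorem fricke_H:
  assumes "Im \<tau> > 0"
  shows "H (- 1 / (13 * \<tau>)) $ 1 = 1 / of_real (sqrt 13) * (gamma13 * H \<tau> $ 1 + beta13 * H \<tau> $ 2)"
    and "H (- 1 / (13 * \<tau>)) $ 2 = 1 / of_real (sqrt 13) * (alpha13 * H \<tau> $ 1 - gamma13 * H \<tau> $ 2)"
proof -
  let ?U = "{\<tau>. Im \<tau> > 0}"
  define s where "s = complex_of_real (sqrt 13)"
  have s2: "s ^ 2 = 13"
    unfolding s_def by (simp flip: of_real_power)
  obtain k where k: "\<And>\<tau>. Im \<tau> > 0 \<Longrightarrow> \<exists>K. K ^ 6 = k \<and>
    H (- 1 / (13 * \<tau>)) $ 1 = K * (gamma13 * H \<tau> $ 1 + beta13 * H \<tau> $ 2) \<and>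
    H (- 1 / (13 * \<tau>)) $ 2 = K * (alpha13 * H \<tau> $ 1 - gamma13 * H \<tau> $ 2)"
    using fricke_up_to_scalar by blast
  define den where "den = (\<lambda>\<tau>. gamma13 * H \<tau> $ 1 + beta13 * H \<tau> $ 2)"
  define K where "K = (\<lambda>\<tau>. H (- 1 / (13 * \<tau>)) $ 1 / den \<tau>)"
  have inv: "Im (- 1 / (13 * \<tau>)) > 0" if "Im \<tau> > 0" for \<tau>
    by (rule Im_neg_inverse_pos) (use that in simp)
  have den: "den \<tau> \<noteq> 0" if "Im \<tau> > 0" for \<tau>
    using k[OF that] H_nonzero[OF inv[OF that]] by (auto simp: den_def)
  have K: "K \<tau> ^ 6 = k" "H (- 1 / (13 * \<tau>)) $ 1 = K \<tau> * den \<tau>"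
      "H (- 1 / (13 * \<tau>)) $ 2 = K \<tau> * (alpha13 * H \<tau> $ 1 - gamma13 * H \<tau> $ 2)" if "Im \<tau> > 0" for \<tau>
    using k[OF that] den[OF that] unfolding K_def den_def by auto
  have cont: "continuous_on ?U K"
    unfolding K_def den_def
    by (intro continuous_intros H_continuous continuous_on_compose2[OF H_continuous(1)])
       (use inv den in \<open>auto simp: den_def\<close>)
  have "K constant_on ?U"
  proof (rule continuous_finite_range_constant[OF _ cont])
    show "connected ?U"
      by (intro convex_connected convex_halfspace_Im_gt)
    have "finite {z::complex. z ^ 6 = k}"
      by (rule finite_nth_roots) simp
    thus "finite (K ` ?U)"
      by (rule finite_subset[rotated]) (use K(1) in auto)
  qed
  then obtain c where c: "\<And>\<tau>. Im \<tau> > 0 \<Longrightarrow> K \<tau> = c"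
    unfolding constant_on_def by auto
  \<comment> \<open>The fixed point of \<open>\<tau> \<mapsto> - 1 / (13 \<tau>)\<close>.\<close>
  define t where "t = complex_of_real (1 / sqrt 13) * \<i>"
  have t: "Im t > 0" by (simp add: t_def)
  have "13 * t * t = - 1"
    unfolding t_def by (simp add: power2_eq_square[symmetric] power_divide flip: of_real_power)
  hence "- 1 / (13 * t) = 13 * t * t / (13 * t)" by simp
  hence fixed: "- 1 / (13 * t) = t"
    using t by auto
  obtain x y where xy: "x > 0" "y > 0" "H t $ 1 = of_real x" "H t $ 2 = of_real y"
    using H_imaginary_axis[of "1 / sqrt 13"] unfolding t_def by auto
  have e1: "of_real x = c * (gamma13 * of_real x + beta13 * of_real y)"
   and e2: "of_real y = c * (alpha13 * of_real x - gamma13 * of_real y)"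
    using K(2,3)[OF t] unfolding fixed c[OF t] den_def xy by simp_all
  have "gamma13 * of_real x + beta13 * of_real y =
          c * ((gamma13 * gamma13 + alpha13 * beta13) * of_real x)"
    by (subst e1, subst e2) (simp add: algebra_simps)
  hence "of_real x = (c ^ 2 * 13) * of_real x"
    unfolding period_relations(5) using e1 by (simp add: power2_eq_square algebra_simps)
  hence "c ^ 2 * 13 = 1"
    using xy(1) by simp
  hence "(c * s) ^ 2 = 1 ^ 2"
    by (simp add: power_mult_distrib s2)
  hence cs: "c * s = 1 \<or> c * s = - 1"
    unfolding power2_eq_iff .
  have "c * s \<noteq> - 1"
  proof
    assume neg: "c * s = - 1"
    have "s * of_real x = (c * s) * (gamma13 * of_real x + beta13 * of_real y)"
      using e1 by (metis mult.assoc mult.commute)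
    hence "Re (s * of_real x) = Re (- (gamma13 * of_real x + beta13 * of_real y))"
      unfolding neg by simp
    hence eq: "(sqrt 13 + Re gamma13) * x + Re beta13 * y = 0"
      by (simp add: s_def algebra_simps)
    have pos: "Re beta13 > 0" "Re alpha13 > 0"
      using cos13_less[of 1 4] cos13_less[of 5 6] cos13_less[of 2 4] cos13_less[of 3 6] by (simp_all add: cubic_periods)
    have im: "Im alpha13 = 0" "Im beta13 = 0" "Im gamma13 = 0"
      by (simp_all add: cubic_periods cos13_Im)
    have "Re gamma13 * Re gamma13 + Re alpha13 * Re beta13 = 13"
      using arg_cong[OF period_relations(5), of Re] by (simp add: im)
    hence "(Re gamma13)\<^sup>2 < 13"
      using mult_pos_pos[OF pos] by (simp add: power2_eq_square mult.commute)
    hence "\<bar>Re gamma13\<bar> < sqrt 13"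
      using real_less_rsqrt[of "\<bar>Re gamma13\<bar>" 13] by simp
    hence "sqrt 13 + Re gamma13 > 0" by linarith
    from add_pos_pos[OF mult_pos_pos[OF this xy(1)] mult_pos_pos[OF pos(1) xy(2)]]
    show False using eq by simp
  qed
  hence "c = 1 / s"
    using cs by (auto simp: s_def field_simps)
  thus "H (- 1 / (13 * \<tau>)) $ 1 = 1 / of_real (sqrt 13) * (gamma13 * H \<tau> $ 1 + beta13 * H \<tau> $ 2)"
    "H (- 1 / (13 * \<tau>)) $ 2 = 1 / of_real (sqrt 13) * (alpha13 * H \<tau> $ 1 - gamma13 * H \<tau> $ 2)"
    using K(2,3)[OF assms] c[OF assms] by (simp_all only: s_def den_def)
qed

lemma H_plus_1: "H (\<tau> + 1) = exp (- (of_real pi * \<i>) / 3) *s H \<tau>"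
proof -
  have "nome (\<tau> + 1) = nome \<tau>"
    using nome_of_int[of 1] by (simp add: nome_add)
  moreover have "nome_powr (\<tau> + 1) (-1/6) = exp (- (of_real pi * \<i>) / 3) * nome_powr \<tau> (-1/6)"
    unfolding nome_powr_def exp_add[symmetric] by (rule arg_cong[of _ _ exp]) (simp add: algebra_simps)
  ultimately show ?thesis
    by (simp add: vec_eq_iff forall_2 H_def mult.assoc)
qed

theorem theorem1p1:
  shows "(\<forall>\<tau>::complex. Im \<tau> > 0 \<longrightarrow> H (- 1 / (13 * \<tau>)) = S13 *v H \<tau>) \<and>
    S13 ** S13 = mat 1 \<and>
    (\<forall>\<tau>::complex. Im \<tau> > 0 \<longrightarrow> H (\<tau> + 1) = exp (- (of_real pi * \<i>) / 3) *s H \<tau>)"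
proof (intro conjI allI impI)
  fix \<tau> :: complex assume "Im \<tau> > 0"
  from fricke_H[OF this] show "H (- 1 / (13 * \<tau>)) = S13 *v H \<tau>"
    by (simp add: vec_eq_iff forall_2 matrix_vector_mult_def sum_2 S13_def field_simps)
next
  have "complex_of_real (sqrt 13) * of_real (sqrt 13) = 13"
    by (simp flip: of_real_mult)
  thus "S13 ** S13 = mat 1"
    using period_relations(5)
    by (simp add: vec_eq_iff forall_2 matrix_matrix_mult_def sum_2 S13_def mat_def field_simps)
qed (rule H_plus_1)

end
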